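(* The $\mathbb C$-algebras $\mathbb I^{*}$ and $\widehat I_M$ are isomorphic.
   Context: Fix real numbers $a<b$. $\boldsymbol{B_1}$ is the algebra of smooth functions $P:[a,b]\to\mathbb C$. $\Delta=\{(x,y): a\le y\le x\le b\}$, and $\boldsymbol{B_2}$ is the algebra of smooth functions $f:\Delta\to\mathbb C$ (all partial derivatives of all orders exist and are continuous on $\Delta$). $M[a,b]$ is the vector space of all smooth functions $\phi:[a,b]\to\mathbb C$ with $\phi(a)=0$ and $\frac{d^k\phi}{dx^k}(a)=0$ for all $k\ge 1$. $\widehat I_M$ is the subalgebra of $\mathrm{End}_{\mathbb C}(M[a,b])$ generated by the multiplication operators $P(x):\phi\mapsto P\phi$ ($P\in\boldsymbol{B_1}$), the derivative $\partial_x:\phi\mapsto\phi'$, and the Volterra operators $f(x,y)\theta(x-y):\phi\mapsto\int_a^x f(x,z)\phi(z)\,dz$ ($f\in\boldsymbol{B_2}$). Let $\mathcal D\subset\widehat I_M$ be the free left $\boldsymbol{B_1}$-module on $\{1,\partial_x,\partial_x^2,\dots\}$ and $\mathcal G=\{g(x,y)\theta(x-y): g\in\boldsymbol{B_2}\}\subset\widehat I_M$. Set $\mathbb I^{*}=\mathcal D\oplus\mathcal G$; with $\widehat\beta=(1,0)$, $\widehat\theta=(0,1)$, its elements are written $\big(\sum_{i=1}^nP_i\partial_x^i+P_0\big)\widehat\beta+f(x,y)\widehat\theta$. The map $\xi:\widehat I_M\to\mathbb I^*$, $\big(\sum_{i=1}^nP_i\partial_x^i+P_0\big)+f(x,y)\theta(x-y)\mapsto\big(\sum_{i=1}^nP_i\partial_x^i+P_0\big)\widehat\beta+f(x,y)\widehat\theta$,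 is a $\mathbb C$-linear bijection. $\mathbb I^{*}$ is given, via $\xi$, the $\mathbb C$-algebra structure with identity $\widehat\beta$ whose multiplication $\bullet$ satisfies the rules: $f\widehat\theta\bullet g\widehat\theta=\big(\int_y^x f(x,z)g(z,y)\,dz\big)\widehat\theta$; $P(x)\widehat\beta\bullet f\widehat\theta=(P(x)f(x,y))\widehat\theta$; $f\widehat\theta\bullet P(x)\widehat\beta=(P(y)f(x,y))\widehat\theta$; $\partial_x\widehat\beta\bullet f\widehat\theta=(\partial_xf)\widehat\theta+f(x,x)\widehat\beta$; $f\widehat\theta\bullet\partial_x\widehat\beta=-(\partial_yf)\widehat\theta+f(x,x)\widehat\beta$; $\partial_x^n\widehat\beta\bullet\partial_x^m\widehat\beta=\partial_x^{n+m}\widehat\beta$; $P\widehat\beta\bullet Q\widehat\beta=PQ\,\widehat\beta$; $P\widehat\beta\bullet\partial_x\widehat\beta=P\partial_x\widehat\beta$; $\partial_x\widehat\beta\bullet P\widehat\beta=P'\widehat\beta+P\partial_x\widehat\beta$ (for $f,g\in\boldsymbol{B_2}$, $P,Q\in\boldsymbol{B_1}$). *)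

theory Defs
  imports "HOL-Analysis.Analysis" "HOL-Algebra.Module" "HOL-Algebra.QuotRing"
    "HOL-Library.Function_Algebras"
begin

section \<open>Algebras over the complex numbers\<close>

text \<open>
  The locale \<open>algebra\<close> of \<open>HOL-Algebra\<close> demands commutativity, so associative unital algebras
  are put together from \<open>ring\<close> and \<open>module\<close>.
\<close>

definition complex_field :: "complex ring" where
  "complex_field = \<lparr>carrier = UNIV, mult = (*), one = 1, zero = 0, add = (+)\<rparr>"

definition complex_algebra :: "(complex, 'v) module \<Rightarrow> bool" where
  "complex_algebra A \<longleftrightarrow> Ring.ring A \<and> Module.module complex_field A \<and>
     (\<forall>c. \<forall>x\<in>carrier A. \<forall>y\<in>carrier A.
        (c \<odot>\<^bsub>A\<^esub> x) \<otimes>\<^bsub>A\<^esub> y = c \<odot>\<^bsub>A\<^esub> (x \<otimes>\<^bsub>A\<^esub> y) \<and>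
        x \<otimes>\<^bsub>A\<^esub> (c \<odot>\<^bsub>A\<^esub> y) = c \<odot>\<^bsub>A\<^esub> (x \<otimes>\<^bsub>A\<^esub> y))"

definition algebra_iso :: "(complex, 'v) module \<Rightarrow> (complex, 'w) module \<Rightarrow> ('v \<Rightarrow> 'w) set" where
  "algebra_iso A B = {h \<in> ring_iso A B. \<forall>c. \<forall>x\<in>carrier A. h (c \<odot>\<^bsub>A\<^esub> x) = c \<odot>\<^bsub>B\<^esub> h x}"

definition algebra_isomorphic :: "(complex, 'v) module \<Rightarrow> (complex, 'w) module \<Rightarrow> bool" where
  "algebra_isomorphic A B \<longleftrightarrow> algebra_iso A B \<noteq> {}"

inductive_set generated_subalgebra :: "(complex, 'v) module \<Rightarrow> 'v set \<Rightarrow> 'v set"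
  for A :: "(complex, 'v) module" and S :: "'v set" where
  gen: "s \<in> S \<Longrightarrow> s \<in> generated_subalgebra A S"
| one: "\<one>\<^bsub>A\<^esub> \<in> generated_subalgebra A S"
| add: "x \<in> generated_subalgebra A S \<Longrightarrow> y \<in> generated_subalgebra A S \<Longrightarrow>
    x \<oplus>\<^bsub>A\<^esub> y \<in> generated_subalgebra A S"
| smult: "x \<in> generated_subalgebra A S \<Longrightarrow> c \<odot>\<^bsub>A\<^esub> x \<in> generated_subalgebra A S"
| mult: "x \<in> generated_subalgebra A S \<Longrightarrow> y \<in> generated_subalgebra A S \<Longrightarrow>
    x \<otimes>\<^bsub>A\<^esub> y \<in> generated_subalgebra A S"


section \<open>Smooth functions on the interval and on the triangle\<close>

text \<open>
  Throughout, a function on \<open>[a,b]\<close> or on the triangle is represented by its extension by zero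
  to \<open>real\<close> or \<open>real \<times> real\<close>, so that equality of representatives is equality of functions on
  the domain and the pointwise operations of the function types restrict correctly.
\<close>

definition ideriv :: "real \<Rightarrow> real \<Rightarrow> (real \<Rightarrow> complex) \<Rightarrow> real \<Rightarrow> complex" where
  "ideriv a b f = (\<lambda>x. if x \<in> {a..b} then vector_derivative f (at x within {a..b}) else 0)"

definition B1 :: "real \<Rightarrow> real \<Rightarrow> (real \<Rightarrow> complex) set" where
  "B1 a b = {P. (\<forall>x. x \<notin> {a..b} \<longrightarrow> P x = 0) \<and>
     (\<forall>k. \<forall>x\<in>{a..b}. (ideriv a b ^^ k) P differentiable (at x within {a..b}))}"

definition Delta :: "real \<Rightarrow> real \<Rightarrow> (real \<times> real) set" where
  "Delta a b = {(x, y). a \<le> y \<and> y \<le> x \<and> x \<le> b}"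

text \<open>
  At the corners \<open>(a,a)\<close> and \<open>(b,b)\<close> one of the two coordinate slices of the triangle is a single
  point, so a slicewise partial derivative makes no sense there. Partial derivatives are
  therefore read off the derivative relative to the triangle, which is unique
  (\<open>Delta_derivative_unique\<close> below).
\<close>

definition pdx :: "real \<Rightarrow> real \<Rightarrow> (real \<times> real \<Rightarrow> complex) \<Rightarrow> real \<times> real \<Rightarrow> complex" where
  "pdx a b f = (\<lambda>p. if p \<in> Delta a b
     then frechet_derivative f (at p within Delta a b) (1, 0) else 0)"

definition pdy :: "real \<Rightarrow> real \<Rightarrow> (real \<times> real \<Rightarrow> complex) \<Rightarrow> real \<times> real \<Rightarrow> complex" where
  "pdy a b f = (\<lambda>p. if p \<in> Delta a b
     then frechet_derivative f (at p within Delta a b) (0, 1) else 0)"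

inductive_set iterated_partials ::
    "real \<Rightarrow> real \<Rightarrow> (real \<times> real \<Rightarrow> complex) \<Rightarrow> (real \<times> real \<Rightarrow> complex) set"
  for a b :: real and f :: "real \<times> real \<Rightarrow> complex" where
  base: "f \<in> iterated_partials a b f"
| dx: "g \<in> iterated_partials a b f \<Longrightarrow> pdx a b g \<in> iterated_partials a b f"
| dy: "g \<in> iterated_partials a b f \<Longrightarrow> pdy a b g \<in> iterated_partials a b f"

text \<open>
  Differentiability of every iterated partial derivative makes all of them continuous on the
  triangle; conversely, if all of them exist and are continuous, they are differentiable.
\<close>

definition B2 :: "real \<Rightarrow> real \<Rightarrow> (real \<times> real \<Rightarrow> complex) set" where
  "B2 a b = {f. (\<forall>p. p \<notin> Delta a b \<longrightarrow> f p = 0) \<and>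
     (\<forall>g\<in>iterated_partials a b f. g differentiable_on Delta a b)}"


section \<open>The operator algebra\<close>

definition Mab :: "real \<Rightarrow> real \<Rightarrow> (real \<Rightarrow> complex) set" where
  "Mab a b = {\<phi> \<in> B1 a b. \<forall>k. (ideriv a b ^^ k) \<phi> a = 0}"

text \<open>Operators are extended by zero outside \<open>Mab a b\<close>; composition respects this convention.\<close>

definition on_M :: "real \<Rightarrow> real \<Rightarrow> ((real \<Rightarrow> complex) \<Rightarrow> real \<Rightarrow> complex)
    \<Rightarrow> (real \<Rightarrow> complex) \<Rightarrow> real \<Rightarrow> complex" where
  "on_M a b T = (\<lambda>\<phi>. if \<phi> \<in> Mab a b then T \<phi> else 0)"

definition End_M :: "real \<Rightarrow> real \<Rightarrow> (complex, (real \<Rightarrow> complex) \<Rightarrow> real \<Rightarrow> complex) module" where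
  "End_M a b =
     \<lparr>carrier = {T. (\<forall>\<phi>\<in>Mab a b. T \<phi> \<in> Mab a b) \<and> (\<forall>\<phi>. \<phi> \<notin> Mab a b \<longrightarrow> T \<phi> = 0) \<and>
        (\<forall>\<phi>\<in>Mab a b. \<forall>\<psi>\<in>Mab a b. T (\<phi> + \<psi>) = T \<phi> + T \<psi>) \<and>
        (\<forall>c. \<forall>\<phi>\<in>Mab a b. T (\<lambda>x. c * \<phi> x) = (\<lambda>x. c * T \<phi> x))},
      mult = (\<circ>), one = on_M a b id, zero = 0, add = (+),
      smult = (\<lambda>c T \<phi> x. c * T \<phi> x)\<rparr>"

definition mult_op :: "real \<Rightarrow> real \<Rightarrow> (real \<Rightarrow> complex) \<Rightarrow> (real \<Rightarrow> complex) \<Rightarrow> real \<Rightarrow> complex" where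
  "mult_op a b P = on_M a b (\<lambda>\<phi>. P * \<phi>)"

definition deriv_op :: "real \<Rightarrow> real \<Rightarrow> (real \<Rightarrow> complex) \<Rightarrow> real \<Rightarrow> complex" where
  "deriv_op a b = on_M a b (ideriv a b)"

definition volterra_op ::
    "real \<Rightarrow> real \<Rightarrow> (real \<times> real \<Rightarrow> complex) \<Rightarrow> (real \<Rightarrow> complex) \<Rightarrow> real \<Rightarrow> complex" where
  "volterra_op a b f = on_M a b
     (\<lambda>\<phi> x. if x \<in> {a..b} then integral {a..x} (\<lambda>z. f (x, z) * \<phi> z) else 0)"

definition I_M :: "real \<Rightarrow> real \<Rightarrow> (complex, (real \<Rightarrow> complex) \<Rightarrow> real \<Rightarrow> complex) module" where
  "I_M a b = (End_M a b)\<lparr>carrier := generated_subalgebra (End_M a b)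
     (mult_op a b ` B1 a b \<union> {deriv_op a b} \<union> volterra_op a b ` B2 a b)\<rparr>"


section \<open>The algebra of formal sums\<close>

text \<open>
  The pair \<open>(p, f)\<close> stands for the formal sum of the \<open>p i \<partial>\<^sub>x\<^sup>i \<beta>\<close> and \<open>f \<theta>\<close>: its first component is
  an element of the free left \<open>B1\<close>-module on the powers of \<open>\<partial>\<^sub>x\<close>, that is, a finitely supported
  sequence of coefficients. The multiplication is the one forced by bilinearity, associativity
  and the rules for generators, which are recovered as lemmas at the end of this theory.
\<close>

type_synonym istar = "(nat \<Rightarrow> real \<Rightarrow> complex) \<times> (real \<times> real \<Rightarrow> complex)"

definition beta :: "(real \<Rightarrow> complex) \<Rightarrow> nat \<Rightarrow> istar" where
  "beta P n = ((\<lambda>k. if k = n then P else 0), 0)"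

definition theta :: "(real \<times> real \<Rightarrow> complex) \<Rightarrow> istar" where
  "theta f = (0, f)"

definition unit1 :: "real \<Rightarrow> real \<Rightarrow> real \<Rightarrow> complex" where
  "unit1 a b = indicator {a..b}"

definition diag :: "(real \<times> real \<Rightarrow> complex) \<Rightarrow> real \<Rightarrow> complex" where
  "diag f = (\<lambda>x. f (x, x))"

definition conv :: "real \<Rightarrow> real \<Rightarrow> (real \<times> real \<Rightarrow> complex) \<Rightarrow> (real \<times> real \<Rightarrow> complex)
    \<Rightarrow> real \<times> real \<Rightarrow> complex" where
  "conv a b f g = (\<lambda>(x, y). if (x, y) \<in> Delta a b
     then integral {y..x} (\<lambda>z. f (x, z) * g (z, y)) else 0)"

text \<open>Left multiplication by \<open>P \<beta>\<close>, left multiplication by \<open>\<partial>\<^sub>x \<beta>\<close>, right multiplication by \<open>\<partial>\<^sub>x \<beta>\<close>:\<close>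

definition lmul :: "(real \<Rightarrow> complex) \<Rightarrow> istar \<Rightarrow> istar" where
  "lmul P = (\<lambda>(q, g). (\<lambda>k. P * q k, \<lambda>(x, y). P x * g (x, y)))"

definition lder :: "real \<Rightarrow> real \<Rightarrow> istar \<Rightarrow> istar" where
  "lder a b = (\<lambda>(q, g). (\<lambda>k. ideriv a b (q k) + (if k = 0 then diag g else q (k - 1)), pdx a b g))"

definition rder :: "real \<Rightarrow> real \<Rightarrow> istar \<Rightarrow> istar" where
  "rder a b = (\<lambda>(q, g). (\<lambda>k. if k = 0 then diag g else q (k - 1), - pdy a b g))"

text \<open>
  The three summands are \<open>p i \<partial>\<^sub>x\<^sup>i \<beta> \<bullet> Y\<close> for the second factor \<open>Y = (q, g)\<close>, then
  \<open>(f \<theta> \<bullet> q j \<beta>) \<bullet> \<partial>\<^sub>x\<^sup>j \<beta>\<close>, and \<open>f \<theta> \<bullet> g \<theta>\<close>.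
\<close>

definition istar_mult :: "real \<Rightarrow> real \<Rightarrow> istar \<Rightarrow> istar \<Rightarrow> istar" where
  "istar_mult a b = (\<lambda>(p, f) (q, g).
     (\<Sum>i\<in>{i. p i \<noteq> 0}. lmul (p i) ((lder a b ^^ i) (q, g))) +
     (\<Sum>j\<in>{j. q j \<noteq> 0}. (rder a b ^^ j) (theta (\<lambda>(x, y). q j y * f (x, y)))) +
     theta (conv a b f g))"

definition I_star :: "real \<Rightarrow> real \<Rightarrow> (complex, istar) module" where
  "I_star a b =
     \<lparr>carrier = {p. (\<forall>i. p i \<in> B1 a b) \<and> finite {i. p i \<noteq> 0}} \<times> B2 a b,
      mult = istar_mult a b, one = beta (unit1 a b) 0, zero = 0, add = (+),
      smult = (\<lambda>c (p, f). (\<lambda>k x. c * p k x, \<lambda>z. c * f z))\<rparr>"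

section \<open>The rules for generators\<close>

lemma Delta_derivative_unique:
  fixes f :: "real \<times> real \<Rightarrow> complex"
  assumes ab: "a < b" and p: "p \<in> Delta a b"
    and f': "(f has_derivative f') (at p within Delta a b)"
    and f'': "(f has_derivative f'') (at p within Delta a b)"
  shows "f' = f''"
proof -
  have lin: "linear f'" "linear f''"
    using f' f'' has_derivative_linear by blast+
  have "convex (Delta a b)"
  proof -
    have "Delta a b = {z. (0, -1) \<bullet> z \<le> - a} \<inter> {z. (-1, 1) \<bullet> z \<le> 0} \<inter> {z. (1, 0) \<bullet> z \<le> b}"
      by (auto simp: Delta_def)
    then show ?thesis
      by (simp only: convex_Int convex_halfspace_le)
  qed
  then have seg: "p + t *\<^sub>R (q - p) \<in> Delta a b" if "q \<in> Delta a b" "t \<in> {0..1}" for q t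
    using that p convexD_alt[of "Delta a b" p q t] by (simp add: algebra_simps)
  have dir: "f' (q - p) = f'' (q - p)" if q: "q \<in> Delta a b" for q
  proof -
    let ?l = "\<lambda>t::real. p + t *\<^sub>R (q - p)"
    have l: "(?l has_vector_derivative (q - p)) (at 0 within {0..1})"
      by (auto intro!: derivative_eq_intros)
    have sub: "?l ` {0..1} \<subseteq> Delta a b"
      using seg[OF q] by blast
    have "((f \<circ> ?l) has_vector_derivative D (q - p)) (at 0 within {0..1})"
      if "(f has_derivative D) (at p within Delta a b)" for D
      by (rule vector_derivative_diff_chain_within[OF l])
         (use has_derivative_subset[OF that sub] in simp)
    from this[OF f'] this[OF f''] show ?thesis
      by (rule vector_derivative_unique_within[rotated]) (simp add: trivial_limit_within)
  qed
  have diff: "f' (q - r) = f'' (q - r)" if "q \<in> Delta a b" "r \<in> Delta a b" for q r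
  proof -
    have "q - r = (q - p) - (r - p)" by simp
    then show ?thesis
      using dir[OF that(1)] dir[OF that(2)]
      by (simp only: linear_diff[OF lin(1)] linear_diff[OF lin(2)])
  qed
  have "f' ((b - a) *\<^sub>R (1, 0)) = f'' ((b - a) *\<^sub>R (1, 0))"
    using diff[of "(b, a)" "(a, a)"] ab by (simp add: Delta_def)
  then have 1: "f' (1, 0) = f'' (1, 0)"
    using ab unfolding linear_scale[OF lin(1)] linear_scale[OF lin(2)] by simp
  have "f' ((b - a) *\<^sub>R (0, 1)) = f'' ((b - a) *\<^sub>R (0, 1))"
    using diff[of "(b, b)" "(b, a)"] ab by (simp add: Delta_def)
  then have 2: "f' (0, 1) = f'' (0, 1)"
    using ab unfolding linear_scale[OF lin(1)] linear_scale[OF lin(2)] by simp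
  have "f' (x, y) = f'' (x, y)" for x y
  proof -
    have "(x, y) = x *\<^sub>R (1, 0) + y *\<^sub>R (0, 1)" by simp
    then show ?thesis
      using 1 2 by (simp only: linear_add[OF lin(1)] linear_add[OF lin(2)]
          linear_scale[OF lin(1)] linear_scale[OF lin(2)])
  qed
  then show ?thesis by auto
qed

lemma pd_zero:
  assumes "a < b"
  shows "pdx a b 0 = 0" "pdy a b 0 = 0"
proof -
  have "frechet_derivative (0 :: real \<times> real \<Rightarrow> complex) (at p within Delta a b) = (\<lambda>_. 0)"
    if p: "p \<in> Delta a b" for p
  proof -
    have "((0 :: real \<times> real \<Rightarrow> complex) has_derivative (\<lambda>_. 0)) (at p within Delta a b)"
      by (simp add: zero_fun_def)
    then show ?thesis
      using Delta_derivative_unique[OF assms p] frechet_derivative_works differentiableI by blast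
  qed
  then show "pdx a b 0 = 0" "pdy a b 0 = 0"
    by (auto simp: pdx_def pdy_def fun_eq_iff)
qed

lemma ideriv_const:
  assumes ab: "a < b" and f: "\<And>x. x \<in> {a..b} \<Longrightarrow> f x = c"
  shows "ideriv a b f = 0"
proof -
  have "vector_derivative f (at x within {a..b}) = 0" if x: "x \<in> {a..b}" for x
  proof -
    have "(f has_vector_derivative 0) (at x within {a..b})"
      by (rule has_vector_derivative_transform[OF x, where f = "\<lambda>_. c"]) (use f in auto)
    then show ?thesis
      by (rule vector_derivative_within_closed_interval[OF ab x])
  qed
  then show ?thesis by (auto simp: ideriv_def fun_eq_iff)
qed

lemma ideriv_unit1: "a < b \<Longrightarrow> ideriv a b (unit1 a b) = 0"
  by (rule ideriv_const[where c = 1]) (auto simp: unit1_def)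

lemma ideriv_zero: "a < b \<Longrightarrow> ideriv a b 0 = 0"
  by (rule ideriv_const[where c = 0]) auto

lemma lder_zero: "a < b \<Longrightarrow> lder a b 0 = 0"
  by (simp add: lder_def zero_prod_def ideriv_zero pd_zero fun_eq_iff diag_def)

lemma rder_zero: "a < b \<Longrightarrow> rder a b 0 = 0"
  by (simp add: rder_def zero_prod_def pd_zero fun_eq_iff diag_def)

lemma rder_pow_zero: "a < b \<Longrightarrow> (rder a b ^^ n) 0 = 0"
  by (induction n) (simp_all add: rder_zero)

lemma conv_zero: "conv a b 0 g = 0" "conv a b f 0 = 0"
  by (auto simp: conv_def fun_eq_iff)

lemma beta_mult:
  assumes ab: "a < b"
  shows "istar_mult a b (beta P n) Y = lmul P ((lder a b ^^ n) Y)"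
proof -
  obtain q g where Y: "Y = (q, g)" by fastforce
  have supp: "{i. (if i = n then P else 0) \<noteq> 0} = (if P = 0 then {} else {n})"
    by auto
  have z: "theta (\<lambda>(x, y). q j y * (0 :: real \<times> real \<Rightarrow> complex) (x, y)) = 0" for j
    by (simp add: theta_def zero_prod_def fun_eq_iff)
  have l0: "lmul 0 Z = 0" for Z
    by (cases Z) (simp add: lmul_def zero_prod_def fun_eq_iff)
  show ?thesis
    unfolding Y istar_mult_def beta_def prod.case supp z rder_pow_zero[OF ab] conv_zero
    by (auto simp: l0) (simp_all add: theta_def flip: zero_prod_def)
qed

lemma theta_mult_beta:
  assumes ab: "a < b"
  shows "istar_mult a b (theta f) (beta Q n) =
    (rder a b ^^ n) (theta (\<lambda>(x, y). Q y * f (x, y)))"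
proof -
  have supp: "{j. (if j = n then Q else 0) \<noteq> 0} = (if Q = 0 then {} else {n})"
    by auto
  have z: "theta (\<lambda>(x, y). (0 :: real \<Rightarrow> complex) y * f (x, y)) = 0"
    by (simp add: theta_def zero_prod_def fun_eq_iff)
  show ?thesis
    unfolding istar_mult_def beta_def prod.case supp conv_zero theta_def[of f]
    using z by (auto simp: rder_pow_zero[OF ab]) (simp_all add: theta_def flip: zero_prod_def)
qed

lemma unit1_mult:
  assumes "f \<in> B2 a b"
  shows "(\<lambda>(x, y). unit1 a b y * f (x, y)) = f"
proof -
  have "unit1 a b y * f (x, y) = f (x, y)" for x y
  proof (cases "(x, y) \<in> Delta a b")
    case True
    then show ?thesis by (simp add: Delta_def unit1_def)
  next
    case False
    then show ?thesis using assms by (simp add: B2_def)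
  qed
  then show ?thesis by auto
qed

theorem I_star_theta_theta:
  "istar_mult a b (theta f) (theta g) = theta (conv a b f g)"
  by (simp add: istar_mult_def theta_def zero_fun_def flip: zero_prod_def)

theorem I_star_beta_theta:
  assumes "a < b"
  shows "istar_mult a b (beta P 0) (theta f) = theta (\<lambda>(x, y). P x * f (x, y))"
  unfolding beta_mult[OF assms] by (simp add: lmul_def theta_def fun_eq_iff)

theorem I_star_theta_beta:
  assumes "a < b"
  shows "istar_mult a b (theta f) (beta P 0) = theta (\<lambda>(x, y). P y * f (x, y))"
  by (simp add: theta_mult_beta[OF assms])

theorem I_star_deriv_theta:
  assumes "a < b" and "f \<in> B2 a b"
  shows "istar_mult a b (beta (unit1 a b) 1) (theta f) =
    theta (pdx a b f) + beta (diag f) 0"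
proof -
  have "unit1 a b x * diag f x = diag f x" for x
    using assms(2) by (auto simp: B2_def unit1_def diag_def Delta_def indicator_def)
  moreover have "unit1 a b x * pdx a b f (x, y) = pdx a b f (x, y)" for x y
    by (auto simp: pdx_def unit1_def Delta_def indicator_def)
  ultimately show ?thesis
    unfolding beta_mult[OF assms(1)]
    by (simp add: lmul_def lder_def theta_def beta_def fun_eq_iff ideriv_const[OF assms(1)])
qed

theorem I_star_theta_deriv:
  assumes "a < b" and "f \<in> B2 a b"
  shows "istar_mult a b (theta f) (beta (unit1 a b) 1) =
    theta (- pdy a b f) + beta (diag f) 0"
  by (simp add: theta_mult_beta[OF assms(1)] unit1_mult[OF assms(2)])
     (simp add: rder_def theta_def beta_def fun_eq_iff)

lemma lder_pow_beta:
  assumes "a < b"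
  shows "(lder a b ^^ n) (beta (unit1 a b) m) = beta (unit1 a b) (n + m)"
proof (induction n)
  case (Suc n)
  then show ?case
    by (auto simp: lder_def beta_def fun_eq_iff pd_zero[OF assms] diag_def
        ideriv_zero[OF assms] ideriv_unit1[OF assms])
qed simp

theorem I_star_deriv_pow:
  assumes "a < b"
  shows "istar_mult a b (beta (unit1 a b) n) (beta (unit1 a b) m) =
    beta (unit1 a b) (n + m)"
  unfolding beta_mult[OF assms] lder_pow_beta[OF assms]
  by (auto simp: lmul_def beta_def unit1_def fun_eq_iff indicator_def)

theorem I_star_beta_beta:
  assumes "a < b"
  shows "istar_mult a b (beta P 0) (beta Q 0) = beta (P * Q) 0"
  unfolding beta_mult[OF assms] by (auto simp: lmul_def beta_def fun_eq_iff)

theorem I_star_beta_deriv: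
  assumes "a < b" and "P \<in> B1 a b"
  shows "istar_mult a b (beta P 0) (beta (unit1 a b) 1) = beta P 1"
  unfolding beta_mult[OF assms(1)] using assms(2)
  by (auto simp: lmul_def beta_def fun_eq_iff unit1_def B1_def indicator_def)

theorem I_star_deriv_beta:
  assumes "a < b" and "P \<in> B1 a b"
  shows "istar_mult a b (beta (unit1 a b) 1) (beta P 0) =
    beta (ideriv a b P) 0 + beta P 1"
proof -
  have "unit1 a b x * ideriv a b P x = ideriv a b P x" "unit1 a b x * P x = P x" for x
    using assms(2) by (auto simp: B1_def unit1_def ideriv_def indicator_def)
  then show ?thesis
    unfolding beta_mult[OF assms(1)]
    by (auto simp: lmul_def lder_def beta_def fun_eq_iff pd_zero[OF assms(1)] diag_def
        ideriv_const[OF assms(1)])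
qed

end

theory Submission
  imports Defs
begin

text \<open>
  A formal sum \<open>(p, f)\<close> acts on the space \<open>Mab a b\<close> of functions flat at \<open>a\<close> by sending \<open>\<phi>\<close> to
  the sum of all \<open>p i * (ideriv a b ^^ i) \<phi>\<close>, plus the
  function \<open>\<lambda>x. integral {a..x} (\<lambda>z. f (x, z) * \<phi> z)\<close>; call this operator \<open>Phi (p, f)\<close>. The theorem holds
  because \<open>Phi\<close> respects all algebra operations (\<open>Phi_add\<close>, \<open>Phi_smult\<close>, \<open>Phi_mult\<close>), is injective
  (\<open>Phi_inj\<close>), and has exactly the algebra generated by multiplications, differentiation and
  Volterra operators as its image (\<open>Phi_image\<close>). Associativity of the product of formal sums is
  then inherited from composition of operators, so it is never computed
  (\<open>complex_algebra_pullback\<close>).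

  Multiplicativity rests on three facts on Volterra operators, matching the rules in which a kernel
  meets the derivative on its left, on its right, or another kernel: differentiation of the integral (\<open>ideriv_volterra\<close>),
  integration by parts (\<open>volterra_ideriv\<close>), where flatness kills the boundary term at \<open>a\<close>, and
  Fubini's theorem on a triangle (\<open>volterra_conv\<close>). That the composition of two smooth kernels is
  smooth up to the boundary of the triangle, corners included, is \<open>conv_deriv\<close> and \<open>conv_B2\<close>: the
  substitution \<open>z = y + s (x - y)\<close> turns the integral over \<open>[y, x]\<close> into one over \<open>[0, 1]\<close>, to which
  Leibniz' rule applies, and the resulting partial derivatives are again built from smooth
  functions and compositions of kernels.

  For injectivity, multiply \<open>exp (-1 / (z - a))\<close> by an arbitrary polynomial to obtain flat
  functions. A further factor \<open>(z - x) ^ N\<close> kills all derivatives of order below \<open>N\<close> at a given point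
  \<open>x\<close>. If \<open>Phi (p, f) = 0\<close>, evaluation at \<open>x\<close> with large \<open>N\<close> thus leaves only the integral, which
  says that \<open>\<lambda>z. f (x, z) * (z - x) ^ N * exp (-1 / (z - a))\<close> is orthogonal to every polynomial; by
  Weierstrass' theorem \<open>f\<close> vanishes (\<open>act_zero_kernel\<close>). With \<open>N\<close> equal to the order of the
  remaining differential operator, the same evaluation returns a nonzero multiple of the leading
  coefficient at \<open>x\<close>, which vanishes too (\<open>act_zero_coeff\<close>).
\<close>

section \<open>Complex algebras\<close>

lemma cring_complex_field: "cring complex_field"
proof (rule cringI)
  show "abelian_group complex_field"
  proof (rule abelian_groupI)
    show "\<exists>y\<in>carrier complex_field. y \<oplus>\<^bsub>complex_field\<^esub> x = \<zero>\<^bsub>complex_field\<^esub>" for x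
      by (rule bexI[of _ "- x"]) (simp_all add: complex_field_def)
  qed (simp_all add: complex_field_def)
  show "comm_monoid complex_field"
    by (rule comm_monoidI) (simp_all add: complex_field_def)
qed (simp add: complex_field_def distrib_right)

text \<open>
  Additive inverses need no separate clause: \<open>(-1) \<odot> x\<close> is one, by distributivity and
  \<open>0 \<odot> x = \<zero>\<close>.
\<close>

lemma complex_algebraI:
  fixes A (structure)
  assumes "\<And>x y. x \<in> carrier A \<Longrightarrow> y \<in> carrier A \<Longrightarrow> x \<oplus> y \<in> carrier A"
    and "\<zero> \<in> carrier A"
    and "\<And>x y z. x \<in> carrier A \<Longrightarrow> y \<in> carrier A \<Longrightarrow> z \<in> carrier A \<Longrightarrow> (x \<oplus> y) \<oplus> z = x \<oplus> (y \<oplus> z)"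
    and "\<And>x y. x \<in> carrier A \<Longrightarrow> y \<in> carrier A \<Longrightarrow> x \<oplus> y = y \<oplus> x"
    and "\<And>x. x \<in> carrier A \<Longrightarrow> \<zero> \<oplus> x = x"
    and "\<And>x y. x \<in> carrier A \<Longrightarrow> y \<in> carrier A \<Longrightarrow> x \<otimes> y \<in> carrier A"
    and "\<one> \<in> carrier A"
    and "\<And>x y z. x \<in> carrier A \<Longrightarrow> y \<in> carrier A \<Longrightarrow> z \<in> carrier A \<Longrightarrow> (x \<otimes> y) \<otimes> z = x \<otimes> (y \<otimes> z)"
    and "\<And>x. x \<in> carrier A \<Longrightarrow> \<one> \<otimes> x = x"
    and "\<And>x. x \<in> carrier A \<Longrightarrow> x \<otimes> \<one> = x"
    and "\<And>x y z. x \<in> carrier A \<Longrightarrow> y \<in> carrier A \<Longrightarrow> z \<in> carrier A \<Longrightarrow> (x \<oplus> y) \<otimes> z = (x \<otimes> z) \<oplus> (y \<otimes> z)"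
    and "\<And>x y z. x \<in> carrier A \<Longrightarrow> y \<in> carrier A \<Longrightarrow> z \<in> carrier A \<Longrightarrow> z \<otimes> (x \<oplus> y) = (z \<otimes> x) \<oplus> (z \<otimes> y)"
    and smult: "\<And>c x. x \<in> carrier A \<Longrightarrow> c \<odot> x \<in> carrier A"
    and smult_add: "\<And>c d x. x \<in> carrier A \<Longrightarrow> (c + d) \<odot> x = (c \<odot> x) \<oplus> (d \<odot> x)"
    and "\<And>c x y. x \<in> carrier A \<Longrightarrow> y \<in> carrier A \<Longrightarrow> c \<odot> (x \<oplus> y) = (c \<odot> x) \<oplus> (c \<odot> y)"
    and "\<And>c d x. x \<in> carrier A \<Longrightarrow> (c * d) \<odot> x = c \<odot> (d \<odot> x)"
    and smult_one: "\<And>x. x \<in> carrier A \<Longrightarrow> 1 \<odot> x = x"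
    and smult_zero: "\<And>x. x \<in> carrier A \<Longrightarrow> 0 \<odot> x = \<zero>"
    and "\<And>c x y. x \<in> carrier A \<Longrightarrow> y \<in> carrier A \<Longrightarrow> (c \<odot> x) \<otimes> y = c \<odot> (x \<otimes> y)"
    and "\<And>c x y. x \<in> carrier A \<Longrightarrow> y \<in> carrier A \<Longrightarrow> x \<otimes> (c \<odot> y) = c \<odot> (x \<otimes> y)"
  shows "complex_algebra A"
proof -
  have "\<exists>y\<in>carrier A. y \<oplus> x = \<zero>" if "x \<in> carrier A" for x
    using smult_add[OF that, of "-1" 1] smult_one[OF that] smult_zero[OF that] smult[OF that, of "-1"]
    by auto
  then have "abelian_group A"
    using assms(1-5) by (intro abelian_groupI) auto
  moreover have "monoid A"
    using assms(6-10) by (intro monoidI) auto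
  moreover note cring_complex_field
  ultimately show ?thesis
    unfolding complex_algebra_def using assms
    by (intro conjI ringI moduleI allI ballI) (simp_all add: complex_field_def)
qed

lemma complex_algebraD:
  fixes A (structure)
  assumes "complex_algebra A"
  shows "ring A" "x \<in> carrier A \<Longrightarrow> c \<odot> x \<in> carrier A"
    "x \<in> carrier A \<Longrightarrow> (c + d) \<odot> x = (c \<odot> x) \<oplus> (d \<odot> x)"
    "x \<in> carrier A \<Longrightarrow> y \<in> carrier A \<Longrightarrow> c \<odot> (x \<oplus> y) = (c \<odot> x) \<oplus> (c \<odot> y)"
    "x \<in> carrier A \<Longrightarrow> (c * d) \<odot> x = c \<odot> (d \<odot> x)"
    "x \<in> carrier A \<Longrightarrow> 1 \<odot> x = x"
    "x \<in> carrier A \<Longrightarrow> 0 \<odot> x = \<zero>"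
    "x \<in> carrier A \<Longrightarrow> y \<in> carrier A \<Longrightarrow> (c \<odot> x) \<otimes> y = c \<odot> (x \<otimes> y)"
    "x \<in> carrier A \<Longrightarrow> y \<in> carrier A \<Longrightarrow> x \<otimes> (c \<odot> y) = c \<odot> (x \<otimes> y)"
proof -
  have "Module.module complex_field A"
    using assms by (simp add: complex_algebra_def)
  then interpret M: Module.module complex_field A .
  show "ring A" "x \<in> carrier A \<Longrightarrow> c \<odot> x \<in> carrier A"
    "x \<in> carrier A \<Longrightarrow> (c + d) \<odot> x = (c \<odot> x) \<oplus> (d \<odot> x)"
    "x \<in> carrier A \<Longrightarrow> y \<in> carrier A \<Longrightarrow> c \<odot> (x \<oplus> y) = (c \<odot> x) \<oplus> (c \<odot> y)"
    "x \<in> carrier A \<Longrightarrow> (c * d) \<odot> x = c \<odot> (d \<odot> x)"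
    "x \<in> carrier A \<Longrightarrow> 1 \<odot> x = x"
    "x \<in> carrier A \<Longrightarrow> 0 \<odot> x = \<zero>"
    "x \<in> carrier A \<Longrightarrow> y \<in> carrier A \<Longrightarrow> (c \<odot> x) \<otimes> y = c \<odot> (x \<otimes> y)"
    "x \<in> carrier A \<Longrightarrow> y \<in> carrier A \<Longrightarrow> x \<otimes> (c \<odot> y) = c \<odot> (x \<otimes> y)"
    using assms M.smult_closed[of c x] M.smult_l_distr[of c d x] M.smult_r_distr[of c x y]
      M.smult_assoc1[of c d x] M.smult_one[of x] M.smult_l_null[of x]
    by (simp_all add: complex_algebra_def complex_field_def)
qed

text \<open>
  Every axiom of an algebra is an equation, and an injective map that preserves the operations
  reflects equations. With the inclusion as \<open>h\<close> this covers subalgebras.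
\<close>

lemma complex_algebra_pullback:
  fixes A :: "(complex, 'v) module" and B :: "(complex, 'w) module"
  assumes B: "complex_algebra B"
    and closed: "\<And>x y. x \<in> carrier A \<Longrightarrow> y \<in> carrier A \<Longrightarrow> x \<oplus>\<^bsub>A\<^esub> y \<in> carrier A"
      "\<And>x y. x \<in> carrier A \<Longrightarrow> y \<in> carrier A \<Longrightarrow> x \<otimes>\<^bsub>A\<^esub> y \<in> carrier A"
      "\<And>c x. x \<in> carrier A \<Longrightarrow> c \<odot>\<^bsub>A\<^esub> x \<in> carrier A"
      "\<zero>\<^bsub>A\<^esub> \<in> carrier A" "\<one>\<^bsub>A\<^esub> \<in> carrier A"
    and into: "\<And>x. x \<in> carrier A \<Longrightarrow> h x \<in> carrier B"
    and inj: "\<And>x y. x \<in> carrier A \<Longrightarrow> y \<in> carrier A \<Longrightarrow> h x = h y \<Longrightarrow> x = y"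
    and hom: "\<And>x y. x \<in> carrier A \<Longrightarrow> y \<in> carrier A \<Longrightarrow> h (x \<oplus>\<^bsub>A\<^esub> y) = h x \<oplus>\<^bsub>B\<^esub> h y"
      "\<And>x y. x \<in> carrier A \<Longrightarrow> y \<in> carrier A \<Longrightarrow> h (x \<otimes>\<^bsub>A\<^esub> y) = h x \<otimes>\<^bsub>B\<^esub> h y"
      "\<And>c x. x \<in> carrier A \<Longrightarrow> h (c \<odot>\<^bsub>A\<^esub> x) = c \<odot>\<^bsub>B\<^esub> h x"
      "h \<zero>\<^bsub>A\<^esub> = \<zero>\<^bsub>B\<^esub>" "h \<one>\<^bsub>A\<^esub> = \<one>\<^bsub>B\<^esub>"
  shows "complex_algebra A"
proof -
  interpret B: ring B by (rule complex_algebraD[OF B])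
  note D = complex_algebraD(2-)[OF B]
  show ?thesis
    by (rule complex_algebraI;
        (intro closed | (rule inj, (simp add: closed)+,
          simp add: hom closed into D B.add.m_ac B.m_assoc B.l_distr B.r_distr)))
qed

section \<open>Orthogonality to polynomials\<close>

text \<open>
  Replacing one factor of \<open>v * v\<close> by a polynomial within \<open>e\<close> of \<open>v\<close> changes the integral by at
  most \<open>e\<close> times the integral of \<open>\<bar>v\<bar>\<close>, and turns it into \<open>0\<close>. Hence \<open>v * v\<close> has integral \<open>0\<close>.
\<close>

lemma real_orthogonal_to_polynomials:
  fixes v :: "real \<Rightarrow> real"
  assumes cd: "c < d" and v: "continuous_on {c..d} v"
    and orth: "\<And>q. real_polynomial_function q \<Longrightarrow> integral {c..d} (\<lambda>z. v z * q z) = 0"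
    and z: "z \<in> {c..d}"
  shows "v z = 0"
proof -
  define A where "A = integral {c..d} (\<lambda>z. \<bar>v z\<bar>)"
  define I where "I = integral {c..d} (\<lambda>z. v z * v z)"
  have "A \<ge> 0"
    unfolding A_def by (rule integral_nonneg) (auto intro!: integrable_continuous_real continuous_intros v)
  have bound: "I \<le> e * A" if "e > 0" for e
  proof -
    obtain q where q: "real_polynomial_function q" "\<And>z. z \<in> {c..d} \<Longrightarrow> \<bar>v z - q z\<bar> < e"
      using Stone_Weierstrass_real_polynomial_function[OF compact_Icc v \<open>e > 0\<close>] by metis
    have cq: "continuous_on {c..d} q"
      using q(1) by (intro continuous_on_polymonial_function) (simp add: real_polynomial_function_eq)
    have "I = integral {c..d} (\<lambda>z. v z * v z) - integral {c..d} (\<lambda>z. v z * q z)"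
      using orth[OF q(1)] by (simp add: I_def)
    also have "\<dots> = integral {c..d} (\<lambda>z. v z * v z - v z * q z)"
      by (rule integral_diff[symmetric]) (intro integrable_continuous_real continuous_intros v cq)+
    also have "\<dots> \<le> integral {c..d} (\<lambda>z. e * \<bar>v z\<bar>)"
    proof (rule integral_le)
      show "v z * v z - v z * q z \<le> e * \<bar>v z\<bar>" if "z \<in> {c..d}" for z
      proof -
        have "v z * v z - v z * q z \<le> \<bar>v z\<bar> * \<bar>v z - q z\<bar>"
          by (metis abs_ge_self abs_mult right_diff_distrib)
        also have "\<dots> \<le> \<bar>v z\<bar> * e"
          using q(2)[OF that] by (intro mult_left_mono) auto
        finally show ?thesis by (simp add: mult.commute)
      qed
    qed (intro integrable_continuous_real continuous_intros v cq)+
    also have "\<dots> = e * A"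
      by (simp add: A_def)
    finally show ?thesis .
  qed
  have "I \<ge> 0"
    unfolding I_def by (rule integral_nonneg) (auto intro!: integrable_continuous_real continuous_intros v)
  moreover have "\<not> I > 0"
  proof
    assume "I > 0"
    \<comment> \<open>The factor \<open>A + 1\<close> rather than \<open>A\<close> makes \<open>e = I / (A + 1)\<close> work even for \<open>A = 0\<close>.\<close>
    then have "I \<le> I / (A + 1) * A"
      using \<open>A \<ge> 0\<close> by (intro bound) auto
    with \<open>I > 0\<close> \<open>A \<ge> 0\<close> show False
      by (simp add: field_simps)
  qed
  ultimately have "I = 0" by simp
  moreover have "I = 0 \<longleftrightarrow> (\<forall>z\<in>{c..d}. v z * v z = 0)"
    unfolding I_def by (rule integral_eq_0_iff) (auto intro!: continuous_intros v cd)
  ultimately show ?thesis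
    using z by simp
qed

lemma orthogonal_to_polynomials:
  fixes u :: "real \<Rightarrow> complex"
  assumes cd: "c < d" and u: "continuous_on {c..d} u"
    and orth: "\<And>q. real_polynomial_function q \<Longrightarrow> integral {c..d} (\<lambda>z. u z * of_real (q z)) = 0"
    and z: "z \<in> {c..d}"
  shows "u z = 0"
proof -
  have int: "(\<lambda>z. u z * of_real (q z)) integrable_on {c..d}" if "real_polynomial_function q" for q
  proof -
    have "continuous_on {c..d} q"
      using that by (intro continuous_on_polymonial_function) (simp add: real_polynomial_function_eq)
    then show ?thesis
      by (intro integrable_continuous_real continuous_on_mult continuous_on_of_real u)
  qed
  have "Re (u z) = 0"
  proof (rule real_orthogonal_to_polynomials[OF cd _ _ z])
    show "integral {c..d} (\<lambda>z. Re (u z) * q z) = 0" if "real_polynomial_function q" for q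
      using integral_linear[OF int[OF that] bounded_linear_Re] orth[OF that] by (simp add: o_def)
  qed (intro continuous_intros u)
  moreover have "Im (u z) = 0"
  proof (rule real_orthogonal_to_polynomials[OF cd _ _ z])
    show "integral {c..d} (\<lambda>z. Im (u z) * q z) = 0" if "real_polynomial_function q" for q
      using integral_linear[OF int[OF that] bounded_linear_Im] orth[OF that] by (simp add: o_def)
  qed (intro continuous_intros u)
  ultimately show ?thesis
    by (simp add: complex_eq_iff)
qed

section \<open>Limits and sums of functions\<close>

lemma sum_fun_apply: "(\<Sum>i\<in>I. F i) x = (\<Sum>i\<in>I. F i x)"
  for F :: "'i \<Rightarrow> 'a \<Rightarrow> 'b::comm_monoid_add"
  by (induction I rule: infinite_finite_induct) auto

lemma poly_div_exp_tendsto_0: "((\<lambda>u. poly q u * exp (- u)) \<longlongrightarrow> (0::real)) at_top"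
proof -
  have "((\<lambda>u. \<Sum>i\<le>degree q. coeff q i * (u ^ i / exp u)) \<longlongrightarrow> (\<Sum>i\<le>degree q. coeff q i * 0)) at_top"
    by (intro tendsto_intros tendsto_power_div_exp_0)
  moreover have "poly q u * exp (- u) = (\<Sum>i\<le>degree q. coeff q i * (u ^ i / exp u))" for u
    by (simp add: poly_altdef sum_distrib_right exp_minus divide_inverse mult.assoc)
  ultimately show ?thesis by simp
qed

section \<open>Smooth functions on the interval\<close>

locale proper_interval =
  fixes a b :: real
  assumes ab: "a < b"
begin

lemma ideriv_eqI:
  assumes "x \<in> {a..b}" "(f has_vector_derivative d) (at x within {a..b})"
  shows "ideriv a b f x = d"
  using vector_derivative_within_closed_interval[OF ab assms] assms(1) by (simp add: ideriv_def)

lemma ideriv_outside: "x \<notin> {a..b} \<Longrightarrow> ideriv a b f x = 0"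
  by (auto simp: ideriv_def)

text \<open>
  Smoothness is approached through finite orders: \<open>C1 n f\<close> demands that \<open>f\<close> and its first \<open>n\<close>
  derivatives are differentiable. For a product, a diagonal or an integral, the derivative is a sum of
  terms of the same kind in other smooth functions, so an induction on \<open>n\<close> over all smooth
  arguments proves smoothness of each kind.
\<close>

definition Diff1 :: "(real \<Rightarrow> complex) \<Rightarrow> bool" where
  "Diff1 f \<longleftrightarrow> (\<forall>x. x \<notin> {a..b} \<longrightarrow> f x = 0) \<and> (\<forall>x\<in>{a..b}. f differentiable (at x within {a..b}))"

primrec C1 :: "nat \<Rightarrow> (real \<Rightarrow> complex) \<Rightarrow> bool" where
  "C1 0 = Diff1"
| "C1 (Suc n) = (\<lambda>f. Diff1 f \<and> C1 n (ideriv a b f))"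

lemma B1_iff_C1: "f \<in> B1 a b \<longleftrightarrow> (\<forall>n. C1 n f)"
proof -
  have funpow: "C1 n f \<longleftrightarrow> (\<forall>k\<le>n. Diff1 ((ideriv a b ^^ k) f))" for n f
  proof (induction n arbitrary: f)
    case (Suc n)
    have all_Suc: "(\<forall>k\<le>Suc n. Q k) \<longleftrightarrow> Q 0 \<and> (\<forall>k\<le>n. Q (Suc k))" for Q
      by (metis Suc_le_mono le0 not0_implies_Suc)
    show ?case
      unfolding all_Suc C1.simps Suc by (simp add: funpow_swap1)
  qed simp
  have "(ideriv a b ^^ k) f x = 0" if "f x = 0" "x \<notin> {a..b}" for k x
    using that by (cases k) (simp_all add: ideriv_outside)
  then have "f \<in> B1 a b \<longleftrightarrow> (\<forall>k. Diff1 ((ideriv a b ^^ k) f))"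
    unfolding B1_def mem_Collect_eq Diff1_def
    by (metis funpow_0)
  then show ?thesis
    using funpow by blast
qed

lemma B1_iff: "f \<in> B1 a b \<longleftrightarrow> Diff1 f \<and> ideriv a b f \<in> B1 a b"
proof -
  have "(\<forall>n. Q n) \<longleftrightarrow> Q 0 \<and> (\<forall>n. Q (Suc n))" for Q
    by (metis not0_implies_Suc)
  from this[of "\<lambda>n. C1 n f"] show ?thesis
    by (auto simp: B1_iff_C1)
qed

lemma B1_outside: "f \<in> B1 a b \<Longrightarrow> x \<notin> {a..b} \<Longrightarrow> f x = 0"
  by (auto simp: B1_def)

lemma ideriv_B1: "f \<in> B1 a b \<Longrightarrow> ideriv a b f \<in> B1 a b"
  using B1_iff by blast

lemma ideriv_pow_B1: "f \<in> B1 a b \<Longrightarrow> (ideriv a b ^^ k) f \<in> B1 a b"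
  by (induction k) (auto intro: ideriv_B1)

lemma B1_has_deriv:
  "f \<in> B1 a b \<Longrightarrow> x \<in> {a..b} \<Longrightarrow> (f has_vector_derivative ideriv a b f x) (at x within {a..b})"
  using B1_iff[of f, unfolded Diff1_def] vector_derivative_works[of f "at x within {a..b}"] by (auto simp: ideriv_def)

lemma B1_continuous: "f \<in> B1 a b \<Longrightarrow> continuous_on {a..b} f"
  using B1_has_deriv has_vector_derivative_continuous continuous_on_eq_continuous_within by blast

lemma Diff1_has_deriv:
  "Diff1 f \<Longrightarrow> x \<in> {a..b} \<Longrightarrow> (f has_vector_derivative ideriv a b f x) (at x within {a..b})"
  using vector_derivative_works[of f "at x within {a..b}"] by (auto simp: ideriv_def Diff1_def)

text \<open>
  Functions on the interval are represented by their extensions by zero; \<open>restr\<close> produces the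
  representative of a function given by a formula on the whole line.
\<close>

definition restr :: "(real \<Rightarrow> complex) \<Rightarrow> real \<Rightarrow> complex" where
  "restr q = (\<lambda>x. if x \<in> {a..b} then q x else 0)"

lemma restr_in [simp]: "x \<in> {a..b} \<Longrightarrow> restr q x = q x"
  and restr_out [simp]: "x \<notin> {a..b} \<Longrightarrow> restr q x = 0"
  by (auto simp: restr_def)

lemma Diff1I:
  assumes "\<And>x. x \<notin> {a..b} \<Longrightarrow> f x = 0"
    "\<And>x. x \<in> {a..b} \<Longrightarrow> (f has_vector_derivative d x) (at x within {a..b})"
  shows "Diff1 f" "ideriv a b f = restr d"
proof -
  show "Diff1 f"
    unfolding Diff1_def using assms differentiableI_vector by blast
  show "ideriv a b f = restr d"
    using ideriv_eqI[OF _ assms(2)] ideriv_outside unfolding restr_def by fastforce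
qed

lemma Diff1_restr:
  assumes "\<And>x. x \<in> {a..b} \<Longrightarrow> (q has_vector_derivative d x) (at x within {a..b})"
  shows "Diff1 (restr q)" "ideriv a b (restr q) = restr d"
proof -
  have "(restr q has_vector_derivative d x) (at x within {a..b})" if "x \<in> {a..b}" for x
    by (rule has_vector_derivative_transform[OF that _ assms[OF that]]) simp
  then show "Diff1 (restr q)" "ideriv a b (restr q) = restr d"
    using Diff1I[of "restr q" d] restr_out by blast+
qed

lemma Diff1_add:
  assumes "Diff1 f" "Diff1 g"
  shows "Diff1 (f + g)" "ideriv a b (f + g) = ideriv a b f + ideriv a b g"
proof -
  have d: "(f + g has_vector_derivative ideriv a b f x + ideriv a b g x) (at x within {a..b})"
    if "x \<in> {a..b}" for x
    unfolding plus_fun_def by (intro has_vector_derivative_add Diff1_has_deriv assms that)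
  have z: "(f + g) x = 0" if "x \<notin> {a..b}" for x
    using assms that by (auto simp: Diff1_def)
  show "Diff1 (f + g)"
    by (rule Diff1I[OF z d])
  show "ideriv a b (f + g) = ideriv a b f + ideriv a b g"
    by (subst Diff1I(2)[OF z d]) (auto simp: fun_eq_iff restr_def ideriv_outside)
qed

lemma C1_add: "C1 n f \<Longrightarrow> C1 n g \<Longrightarrow> C1 n (f + g)"
proof (induction n arbitrary: f g)
  case 0
  then show ?case unfolding C1.simps by (rule Diff1_add)
next
  case (Suc n)
  then show ?case
    unfolding C1.simps(2) using Diff1_add by metis
qed

lemma B1_add: "f \<in> B1 a b \<Longrightarrow> g \<in> B1 a b \<Longrightarrow> f + g \<in> B1 a b"
  by (auto simp: B1_iff_C1 intro: C1_add)

lemma ideriv_add: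
  "f \<in> B1 a b \<Longrightarrow> g \<in> B1 a b \<Longrightarrow> ideriv a b (f + g) = ideriv a b f + ideriv a b g"
  by (rule Diff1_add) (simp_all add: B1_iff[of f] B1_iff[of g])

lemma B1_mult_deriv:
  assumes "f \<in> B1 a b" "g \<in> B1 a b"
  shows "Diff1 (f * g)" "ideriv a b (f * g) = ideriv a b f * g + f * ideriv a b g"
proof -
  have d: "(f * g has_vector_derivative f x * ideriv a b g x + ideriv a b f x * g x)
      (at x within {a..b})" if "x \<in> {a..b}" for x
    unfolding times_fun_def by (intro has_vector_derivative_mult B1_has_deriv assms that)
  have z: "(f * g) x = 0" if "x \<notin> {a..b}" for x
    using assms that B1_outside by auto
  show "Diff1 (f * g)"
    by (rule Diff1I[OF z d])
  show "ideriv a b (f * g) = ideriv a b f * g + f * ideriv a b g"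
    by (subst Diff1I(2)[OF z d]) (auto simp: fun_eq_iff restr_def ideriv_outside)
qed

lemma B1_mult: "f \<in> B1 a b \<Longrightarrow> g \<in> B1 a b \<Longrightarrow> f * g \<in> B1 a b"
proof -
  have "C1 n (f * g)" if "f \<in> B1 a b" "g \<in> B1 a b" for n f g
    using that
  proof (induction n arbitrary: f g)
    case 0
    then show ?case unfolding C1.simps by (rule B1_mult_deriv)
  next
    case (Suc n)
    then show ?case
      unfolding C1.simps(2) B1_mult_deriv(2)[OF Suc.prems]
      by (intro conjI B1_mult_deriv C1_add Suc.IH ideriv_B1)
  qed
  then show "f \<in> B1 a b \<Longrightarrow> g \<in> B1 a b \<Longrightarrow> f * g \<in> B1 a b"
    by (auto simp: B1_iff_C1)
qed

lemma ideriv_mult: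
  "f \<in> B1 a b \<Longrightarrow> g \<in> B1 a b \<Longrightarrow> ideriv a b (f * g) = ideriv a b f * g + f * ideriv a b g"
  by (rule B1_mult_deriv)

lemma restr_const: "Diff1 (restr (\<lambda>_. c))" "ideriv a b (restr (\<lambda>_. c)) = 0"
  using Diff1_restr[of "\<lambda>_. c" "\<lambda>_. 0"] by (auto simp: restr_def fun_eq_iff)

lemma zero_eq_restr: "0 = restr (\<lambda>_. 0)"
  by (simp add: restr_def fun_eq_iff)

lemma zero_B1: "0 \<in> B1 a b"
proof -
  have "Diff1 0" "ideriv a b 0 = 0"
    using restr_const[of 0] by (simp_all flip: zero_eq_restr)
  then have "C1 n 0" for n
    by (induction n) (simp_all only: C1.simps simp_thms)
  then show ?thesis by (simp add: B1_iff_C1)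
qed

lemma const_B1: "restr (\<lambda>_. c) \<in> B1 a b"
  using restr_const[of c] zero_B1 by (subst B1_iff) simp

lemma unit1_eq_restr: "unit1 a b = restr (\<lambda>_. 1)"
  by (auto simp: unit1_def restr_def)

lemma unit1_B1: "unit1 a b \<in> B1 a b"
  unfolding unit1_eq_restr by (rule const_B1)

lemma restr_const_times: "f \<in> B1 a b \<Longrightarrow> restr (\<lambda>_. c) * f = (\<lambda>x. c * f x)"
  using B1_outside[of f] by (force simp: restr_def fun_eq_iff)

lemma unit1_times: "f \<in> B1 a b \<Longrightarrow> unit1 a b * f = f"
  by (simp add: unit1_eq_restr restr_const_times)

lemma B1_scale: "f \<in> B1 a b \<Longrightarrow> (\<lambda>x. c * f x) \<in> B1 a b"
  by (simp add: B1_mult const_B1 flip: restr_const_times)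

lemma ideriv_scale: "f \<in> B1 a b \<Longrightarrow> ideriv a b (\<lambda>x. c * f x) = (\<lambda>x. c * ideriv a b f x)"
  using restr_const_times[of f c] restr_const_times[of "ideriv a b f" c]
    ideriv_mult[OF const_B1[of c], of f] 
  by (simp add: restr_const ideriv_B1)

text \<open>
  Multiplication by \<open>shift c\<close> is multiplication by the coordinate centred at \<open>c\<close>; it is used to
  annihilate low-order derivatives at \<open>c\<close>.
\<close>

definition shift :: "real \<Rightarrow> real \<Rightarrow> complex" where
  "shift c = restr (\<lambda>x. of_real (x - c))"

lemma shift_deriv: "Diff1 (shift c)" "ideriv a b (shift c) = unit1 a b"
proof -
  have d: "((\<lambda>x. of_real (x - c)) has_vector_derivative (1::complex)) (at x within {a..b})" for x
    by (auto intro!: derivative_eq_intros)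
  show "Diff1 (shift c)" "ideriv a b (shift c) = unit1 a b"
    unfolding shift_def unit1_eq_restr using Diff1_restr[OF d] by blast+
qed

lemma shift_B1: "shift c \<in> B1 a b"
  using shift_deriv[of c] unit1_B1 by (subst B1_iff) simp

lemma polynomial_B1:
  assumes "real_polynomial_function q"
  shows "restr (\<lambda>x. of_real (q x)) \<in> B1 a b"
  using assms
proof induction
  case (linear q)
  have q: "q x = q 1 * x" for x
    using linear_scale[OF bounded_linear.linear[OF linear], of x 1] by (simp add: mult.commute)
  have "restr (\<lambda>x. of_real (q x)) x = of_real (q 1) * shift 0 x" for x
    unfolding restr_def shift_def q[of x] by simp
  then have "restr (\<lambda>x. of_real (q x)) = (\<lambda>x. of_real (q 1) * shift 0 x)"
    by blast
  then show ?case
    using B1_scale[OF shift_B1] by simp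
next
  case (const c)
  then show ?case by (rule const_B1)
next
  case (add p q)
  have "restr (\<lambda>x. of_real (p x + q x)) = restr (\<lambda>x. of_real (p x)) + restr (\<lambda>x. of_real (q x))"
    by (auto simp: restr_def fun_eq_iff)
  then show ?case
    using B1_add[OF add.IH] by (simp only:)
next
  case (mult p q)
  have "restr (\<lambda>x. of_real (p x * q x)) = restr (\<lambda>x. of_real (p x)) * restr (\<lambda>x. of_real (q x))"
    by (auto simp: restr_def fun_eq_iff)
  then show ?case
    using B1_mult[OF mult.IH] by (simp only:)
qed

lemma ideriv_pow_add:
  "f \<in> B1 a b \<Longrightarrow> g \<in> B1 a b \<Longrightarrow>
    (ideriv a b ^^ k) (f + g) = (ideriv a b ^^ k) f + (ideriv a b ^^ k) g"
  by (induction k) (auto simp: ideriv_add ideriv_pow_B1)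

lemma ideriv_pow_scale:
  "f \<in> B1 a b \<Longrightarrow> (ideriv a b ^^ k) (\<lambda>x. c * f x) = (\<lambda>x. c * (ideriv a b ^^ k) f x)"
  by (induction k) (auto simp: ideriv_scale ideriv_pow_B1)

lemma Mab_B1: "f \<in> Mab a b \<Longrightarrow> f \<in> B1 a b"
  by (simp add: Mab_def)

lemma Mab_at: "f \<in> Mab a b \<Longrightarrow> f a = 0"
  by (auto simp: Mab_def dest: spec[of _ 0])

lemma ideriv_Mab: 
  assumes "f \<in> Mab a b"
  shows "ideriv a b f \<in> Mab a b"
proof -
  have "(ideriv a b ^^ k) (ideriv a b f) a = 0" for k
    using assms unfolding Mab_def
    by (metis (mono_tags, lifting) funpow_Suc_right mem_Collect_eq o_apply)
  then show ?thesis
    using assms by (simp add: Mab_def ideriv_B1)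
qed

lemma ideriv_pow_Mab: "f \<in> Mab a b \<Longrightarrow> (ideriv a b ^^ k) f \<in> Mab a b"
  by (induction k) (auto intro: ideriv_Mab)

lemma zero_Mab: "0 \<in> Mab a b"
proof -
  have "(ideriv a b ^^ k) 0 = 0" for k
    by (induction k) (simp_all only: funpow.simps o_apply id_apply ideriv_zero[OF ab])
  then show ?thesis
    by (simp add: Mab_def zero_B1)
qed

lemma add_Mab: "f \<in> Mab a b \<Longrightarrow> g \<in> Mab a b \<Longrightarrow> f + g \<in> Mab a b"
  by (auto simp: Mab_def B1_add ideriv_pow_add)

lemma scale_Mab: "f \<in> Mab a b \<Longrightarrow> (\<lambda>x. c * f x) \<in> Mab a b"
  by (auto simp: Mab_def B1_scale ideriv_pow_scale)

text \<open>
  By Leibniz' rule every derivative of \<open>P * f\<close> is a sum of products that each contain a derivative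
  of \<open>f\<close>; the induction runs over all \<open>P\<close> and \<open>f\<close> at once.
\<close>

lemma mult_Mab: 
  assumes "P \<in> B1 a b" "f \<in> Mab a b" 
  shows "P * f \<in> Mab a b"
proof -
  have "(ideriv a b ^^ k) (P * f) a = 0" if "P \<in> B1 a b" "f \<in> Mab a b" for k P f
    using that
  proof (induction k arbitrary: P f)
    case 0
    then show ?case by (simp add: Mab_at)
  next
    case (Suc k)
    have "(ideriv a b ^^ Suc k) (P * f) a = 
        (ideriv a b ^^ k) (ideriv a b P * f + P * ideriv a b f) a"
      using Suc.prems by (simp add: funpow_swap1 ideriv_mult Mab_B1)
    also have "\<dots> = 0"
      unfolding ideriv_pow_add[OF B1_mult B1_mult, OF ideriv_B1 Mab_B1 _ ideriv_B1, OF Suc.prems Suc.prems(1) Mab_B1, OF Suc.prems(2)]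
      using Suc.IH[OF ideriv_B1 Suc.prems(2)] Suc.IH[OF _ ideriv_Mab] Suc.prems
      by (simp only: plus_fun_apply add_0_left)
    finally show ?case .
  qed
  then show ?thesis
    using assms by (auto simp: Mab_def B1_mult)
qed

text \<open>
  Leibniz' rule for the \<open>k + 1\<close>-st derivative, where all terms with a second derivative of the
  linear factor drop out.
\<close>

lemma ideriv_pow_shift_mult:
  assumes "f \<in> B1 a b"
  shows "(ideriv a b ^^ Suc k) (shift c * f) =
    shift c * (ideriv a b ^^ Suc k) f + (\<lambda>x. of_nat (Suc k) * (ideriv a b ^^ k) f x)"
proof (induction k)
  case 0
  show ?case
    using ideriv_mult[OF shift_B1 assms, of c] unit1_times[OF assms]
    by (simp only: shift_deriv funpow.simps comp_id) (simp add: fun_eq_iff)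
next
  case (Suc k)
  let ?g = "(ideriv a b ^^ Suc k) f"
  have "?g \<in> B1 a b" "(ideriv a b ^^ k) f \<in> B1 a b"
    using assms ideriv_pow_B1 by blast+
  then have "ideriv a b (shift c * ?g + (\<lambda>x. of_nat (Suc k) * (ideriv a b ^^ k) f x)) =
      unit1 a b * ?g + shift c * ideriv a b ?g + (\<lambda>x. of_nat (Suc k) * ?g x)"
    by (simp add: ideriv_add ideriv_mult ideriv_scale B1_scale B1_mult shift_B1 shift_deriv del: of_nat_Suc)
  also have "\<dots> = shift c * ideriv a b ?g + (\<lambda>x. of_nat (Suc (Suc k)) * ?g x)"
    using unit1_times[OF \<open>?g \<in> B1 a b\<close>] by (simp add: fun_eq_iff algebra_simps)
  finally show ?case
    unfolding funpow.simps(2)[of "Suc k"] o_apply Suc.IH .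
qed

text \<open>
  At \<open>c\<close> the previous rule reduces the order of the derivative and the exponent of the centred
  coordinate simultaneously, contributing the order as a factor.
\<close>

lemma shift_pow_mult_jet:
  assumes "f \<in> B1 a b" "c \<in> {a..b}"
  shows "k < n \<Longrightarrow> (ideriv a b ^^ k) (((*) (shift c) ^^ n) f) c = 0"
    and "(ideriv a b ^^ n) (((*) (shift c) ^^ n) f) c = fact n * f c"
proof -
  have B: "((*) (shift c) ^^ n) f \<in> B1 a b" for n
    using assms by (induction n) (auto intro: B1_mult shift_B1)
  have Xc: "shift c c = 0"
    using assms(2) unfolding shift_def by (subst restr_in) auto
  have step: "(ideriv a b ^^ Suc k) (((*) (shift c) ^^ Suc n) f) c =
      of_nat (Suc k) * (ideriv a b ^^ k) (((*) (shift c) ^^ n) f) c" for n k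
    using ideriv_pow_shift_mult[OF B[of n], of k c] by (simp add: Xc del: of_nat_Suc)
  show "k < n \<Longrightarrow> (ideriv a b ^^ k) (((*) (shift c) ^^ n) f) c = 0"
  proof (induction n arbitrary: k)
    case (Suc n)
    note IH = Suc.IH
    show ?case
    proof (cases k)
      case 0
      then show ?thesis by (simp add: Xc)
    next
      case (Suc j)
      then have "j < n"
        using \<open>k < Suc n\<close> by simp
      then show ?thesis
        unfolding Suc step using IH by (simp only: mult_zero_right)
    qed
  qed simp
  show "(ideriv a b ^^ n) (((*) (shift c) ^^ n) f) c = fact n * f c"
  proof (induction n)
    case (Suc n)
    show ?case
      unfolding step Suc by (simp add: algebra_simps)
  qed simp
qed

section \<open>Smooth functions on the triangle\<close>

lemma Delta_iff: "p \<in> Delta a b \<longleftrightarrow> a \<le> snd p \<and> snd p \<le> fst p \<and> fst p \<le> b"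
  by (cases p) (simp add: Delta_def)

lemma convex_Delta: "convex (Delta a b)"
proof -
  have "Delta a b = {z. (0, -1) \<bullet> z \<le> - a} \<inter> {z. (-1, 1) \<bullet> z \<le> 0} \<inter> {z. (1, 0) \<bullet> z \<le> b}"
    by (auto simp: Delta_def)
  then show ?thesis
    by (simp only: convex_Int convex_halfspace_le)
qed

definition restr2 :: "(real \<times> real \<Rightarrow> complex) \<Rightarrow> real \<times> real \<Rightarrow> complex" where
  "restr2 q = (\<lambda>p. if p \<in> Delta a b then q p else 0)"

lemma restr2_in [simp]: "p \<in> Delta a b \<Longrightarrow> restr2 q p = q p"
  and restr2_out [simp]: "p \<notin> Delta a b \<Longrightarrow> restr2 q p = 0"
  by (auto simp: restr2_def)

definition Diff2 :: "(real \<times> real \<Rightarrow> complex) \<Rightarrow> bool" where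
  "Diff2 f \<longleftrightarrow> (\<forall>p. p \<notin> Delta a b \<longrightarrow> f p = 0) \<and> f differentiable_on Delta a b"

primrec C2 :: "nat \<Rightarrow> (real \<times> real \<Rightarrow> complex) \<Rightarrow> bool" where
  "C2 0 = Diff2"
| "C2 (Suc n) = (\<lambda>f. Diff2 f \<and> C2 n (pdx a b f) \<and> C2 n (pdy a b f))"

lemma pd_eqI:
  assumes p: "p \<in> Delta a b" and f': "(f has_derivative f') (at p within Delta a b)"
  shows "pdx a b f p = f' (1, 0)" "pdy a b f p = f' (0, 1)"
proof -
  have "frechet_derivative f (at p within Delta a b) = f'"
    using Delta_derivative_unique[OF ab p] f' frechet_derivative_works differentiableI by blast
  then show "pdx a b f p = f' (1, 0)" "pdy a b f p = f' (0, 1)"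
    using p by (simp_all add: pdx_def pdy_def)
qed

lemma pd_outside: "p \<notin> Delta a b \<Longrightarrow> pdx a b f p = 0" "p \<notin> Delta a b \<Longrightarrow> pdy a b f p = 0"
  by (simp_all add: pdx_def pdy_def)

text \<open>
  The derivative relative to the triangle is unique and linear, hence determined by its values on
  the two coordinate vectors, also at the corners where one coordinate line meets the triangle in
  a single point.
\<close>

lemma Diff2_has_derivative:
  assumes "Diff2 f" "p \<in> Delta a b"
  shows "(f has_derivative (\<lambda>h. fst h *\<^sub>R pdx a b f p + snd h *\<^sub>R pdy a b f p))
    (at p within Delta a b)"
proof -
  obtain f' where f': "(f has_derivative f') (at p within Delta a b)"
    using assms unfolding Diff2_def differentiable_on_def differentiable_def by blast
  have lin: "linear f'"
    using f' has_derivative_linear by blast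
  have "f' h = fst h *\<^sub>R f' (1, 0) + snd h *\<^sub>R f' (0, 1)" for h
  proof -
    have "h = fst h *\<^sub>R (1, 0) + snd h *\<^sub>R (0, 1)" by (cases h) simp
    then have "f' h = f' (fst h *\<^sub>R (1, 0) + snd h *\<^sub>R (0, 1))" by simp
    then show ?thesis
      by (simp only: linear_add[OF lin] linear_scale[OF lin])
  qed
  then have "f' = (\<lambda>h. fst h *\<^sub>R f' (1, 0) + snd h *\<^sub>R f' (0, 1))"
    by blast
  with f' show ?thesis
    unfolding pd_eqI[OF assms(2) f'] by (rule has_derivative_eq_rhs)
qed

lemma Diff2I:
  assumes "\<And>p. p \<notin> Delta a b \<Longrightarrow> f p = 0"
    and d: "\<And>p. p \<in> Delta a b \<Longrightarrow>
      (f has_derivative (\<lambda>h. fst h *\<^sub>R dx p + snd h *\<^sub>R dy p)) (at p within Delta a b)"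
  shows "Diff2 f" "pdx a b f = restr2 dx" "pdy a b f = restr2 dy"
proof -
  show "Diff2 f"
    unfolding Diff2_def differentiable_on_def differentiable_def using assms by blast
  have "pdx a b f p = restr2 dx p \<and> pdy a b f p = restr2 dy p" for p
    using pd_eqI[OF _ d, of p] pd_outside[of p f]
    by (cases "p \<in> Delta a b") (simp_all add: restr2_def)
  then show "pdx a b f = restr2 dx" "pdy a b f = restr2 dy"
    by blast+
qed

lemma Diff2_restr2:
  assumes "\<And>p. p \<in> Delta a b \<Longrightarrow>
      (q has_derivative (\<lambda>h. fst h *\<^sub>R dx p + snd h *\<^sub>R dy p)) (at p within Delta a b)"
  shows "Diff2 (restr2 q)" "pdx a b (restr2 q) = restr2 dx" "pdy a b (restr2 q) = restr2 dy"
proof -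
  have "(restr2 q has_derivative (\<lambda>h. fst h *\<^sub>R dx p + snd h *\<^sub>R dy p)) (at p within Delta a b)"
    if "p \<in> Delta a b" for p
    by (rule has_derivative_transform[OF that _ assms[OF that]]) simp
  from Diff2I[OF restr2_out this]
  show "Diff2 (restr2 q)" "pdx a b (restr2 q) = restr2 dx" "pdy a b (restr2 q) = restr2 dy"
    by blast+
qed

lemma iterated_partials_trans:
  "h \<in> iterated_partials a b g \<Longrightarrow> g \<in> iterated_partials a b f \<Longrightarrow> h \<in> iterated_partials a b f"
proof (induction rule: iterated_partials.induct)
  case base
  then show ?case .
next
  case (dx h)
  then show ?case by (intro iterated_partials.dx)
next
  case (dy h)
  then show ?case by (intro iterated_partials.dy)
qed

lemma B2_D:
  assumes "f \<in> B2 a b"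
  shows "Diff2 f" "pdx a b f \<in> B2 a b" "pdy a b f \<in> B2 a b"
proof -
  have *: "g differentiable_on Delta a b" if "g \<in> iterated_partials a b f" for g
    using assms that unfolding B2_def by blast
  have "\<forall>p. p \<notin> Delta a b \<longrightarrow> f p = 0"
    using assms unfolding B2_def by blast
  then show "Diff2 f"
    unfolding Diff2_def using *[OF iterated_partials.base] by blast
  show "pdx a b f \<in> B2 a b" "pdy a b f \<in> B2 a b"
    unfolding B2_def mem_Collect_eq
    using pd_outside * iterated_partials_trans[OF _ iterated_partials.dx[OF iterated_partials.base]]
      iterated_partials_trans[OF _ iterated_partials.dy[OF iterated_partials.base]] by blast+
qed

lemma B2_iff_C2: "f \<in> B2 a b \<longleftrightarrow> (\<forall>n. C2 n f)"
proof
  have "C2 n f" if "f \<in> B2 a b" for n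
    using that by (induction n arbitrary: f) (simp_all only: C2.simps B2_D simp_thms)
  then show "f \<in> B2 a b \<Longrightarrow> \<forall>n. C2 n f" by blast
next
  assume *: "\<forall>n. C2 n f"
  have "\<forall>n. C2 n g" if "g \<in> iterated_partials a b f" for g
    using that
  proof induction
    case base
    show ?case by (rule *)
  next
    case (dx g)
    then show ?case by (metis C2.simps(2))
  next
    case (dy g)
    then show ?case by (metis C2.simps(2))
  qed
  then have "Diff2 g" if "g \<in> iterated_partials a b f" for g
    using that by (metis C2.simps(1))
  then show "f \<in> B2 a b"
    using iterated_partials.base[of f a b] unfolding B2_def Diff2_def by blast
qed

lemmas B2_has_derivative = Diff2_has_derivative[OF B2_D(1)]

lemma B2_outside: "f \<in> B2 a b \<Longrightarrow> p \<notin> Delta a b \<Longrightarrow> f p = 0"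
  using B2_D(1)[of f] unfolding Diff2_def by iprover

lemma B2_continuous: "f \<in> B2 a b \<Longrightarrow> continuous_on (Delta a b) f"
  using B2_D(1)[of f] unfolding Diff2_def by (iprover intro: differentiable_imp_continuous_on)

lemma Diff2_add:
  assumes "Diff2 f" "Diff2 g"
  shows "Diff2 (f + g)" "pdx a b (f + g) = pdx a b f + pdx a b g"
    "pdy a b (f + g) = pdy a b f + pdy a b g"
proof -
  have d: "(f + g has_derivative (\<lambda>h. fst h *\<^sub>R (pdx a b f p + pdx a b g p)
      + snd h *\<^sub>R (pdy a b f p + pdy a b g p))) (at p within Delta a b)"
    if "p \<in> Delta a b" for p
    unfolding plus_fun_def
    by (rule has_derivative_eq_rhs[OF has_derivative_add[OF assms[THEN Diff2_has_derivative, OF that]]])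
      (simp add: fun_eq_iff scaleR_conv_of_real algebra_simps)
  have z: "(f + g) p = 0" if "p \<notin> Delta a b" for p
    using assms that unfolding Diff2_def by (metis add_0_left plus_fun_apply)
  show "Diff2 (f + g)"
    by (rule Diff2I[OF z d])
  show "pdx a b (f + g) = pdx a b f + pdx a b g"
    by (subst Diff2I(2)[OF z d]) (auto simp: fun_eq_iff restr2_def pd_outside)
  show "pdy a b (f + g) = pdy a b f + pdy a b g"
    by (subst Diff2I(3)[OF z d]) (auto simp: fun_eq_iff restr2_def pd_outside)
qed

lemma C2_add: "C2 n f \<Longrightarrow> C2 n g \<Longrightarrow> C2 n (f + g)"
proof (induction n arbitrary: f g)
  case 0
  then show ?case unfolding C2.simps by (rule Diff2_add)
next
  case (Suc n)
  then show ?case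
    unfolding C2.simps(2) using Diff2_add by metis
qed

lemma B2_add: "f \<in> B2 a b \<Longrightarrow> g \<in> B2 a b \<Longrightarrow> f + g \<in> B2 a b"
  unfolding B2_iff_C2 using C2_add by blast

lemma B2_mult_deriv:
  assumes "f \<in> B2 a b" "g \<in> B2 a b"
  shows "Diff2 (f * g)" "pdx a b (f * g) = pdx a b f * g + f * pdx a b g"
    "pdy a b (f * g) = pdy a b f * g + f * pdy a b g"
proof -
  have d: "(f * g has_derivative (\<lambda>h. fst h *\<^sub>R (pdx a b f p * g p + f p * pdx a b g p)
      + snd h *\<^sub>R (pdy a b f p * g p + f p * pdy a b g p))) (at p within Delta a b)"
    if "p \<in> Delta a b" for p
    unfolding times_fun_def
    by (rule has_derivative_eq_rhs[OF has_derivative_mult[OF assms[THEN B2_has_derivative, OF that]]])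
      (simp add: fun_eq_iff scaleR_conv_of_real algebra_simps)
  have z: "(f * g) p = 0" if "p \<notin> Delta a b" for p
    using assms that by (auto simp: B2_outside)
  show "Diff2 (f * g)"
    by (rule Diff2I[OF z d])
  show "pdx a b (f * g) = pdx a b f * g + f * pdx a b g"
    by (subst Diff2I(2)[OF z d]) (use assms in \<open>auto simp: fun_eq_iff restr2_def pd_outside B2_outside\<close>)
  show "pdy a b (f * g) = pdy a b f * g + f * pdy a b g"
    by (subst Diff2I(3)[OF z d]) (use assms in \<open>auto simp: fun_eq_iff restr2_def pd_outside B2_outside\<close>)
qed

lemma B2_mult: "f \<in> B2 a b \<Longrightarrow> g \<in> B2 a b \<Longrightarrow> f * g \<in> B2 a b"
proof -
  have "C2 n (f * g)" if "f \<in> B2 a b" "g \<in> B2 a b" for n f g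
    using that
  proof (induction n arbitrary: f g)
    case 0
    then show ?case unfolding C2.simps by (rule B2_mult_deriv)
  next
    case (Suc n)
    then show ?case
      unfolding C2.simps(2) B2_mult_deriv(2,3)[OF Suc.prems]
      by (intro conjI B2_mult_deriv C2_add Suc.IH B2_D)
  qed
  then show "f \<in> B2 a b \<Longrightarrow> g \<in> B2 a b \<Longrightarrow> f * g \<in> B2 a b"
    unfolding B2_iff_C2 by blast
qed

lemma zero_B2: "0 \<in> B2 a b"
proof -
  have "Diff2 0"
    by (simp add: Diff2_def zero_fun_def)
  then have "C2 n 0" for n
    by (induction n) (simp_all only: C2.simps simp_thms pd_zero[OF ab])
  then show ?thesis
    by (simp add: B2_iff_C2)
qed

text \<open>
  A function of one variable is lifted to the triangle along either coordinate, so that products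
  such as \<open>P x * f (x, y)\<close> become instances of multiplication in \<open>B2\<close>.
\<close>

definition inx :: "(real \<Rightarrow> complex) \<Rightarrow> real \<times> real \<Rightarrow> complex" where
  "inx P = restr2 (\<lambda>p. P (fst p))"

definition iny :: "(real \<Rightarrow> complex) \<Rightarrow> real \<times> real \<Rightarrow> complex" where
  "iny P = restr2 (\<lambda>p. P (snd p))"

lemma inx_deriv:
  assumes "P \<in> B1 a b"
  shows "Diff2 (inx P)" "pdx a b (inx P) = inx (ideriv a b P)" "pdy a b (inx P) = 0"
proof -
  have d: "((\<lambda>p. P (fst p)) has_derivative (\<lambda>h. fst h *\<^sub>R ideriv a b P (fst p) + snd h *\<^sub>R 0))
      (at p within Delta a b)" if p: "p \<in> Delta a b" for p
  proof -
    have "(P has_derivative (\<lambda>h. h *\<^sub>R ideriv a b P (fst p))) (at (fst p) within {a..b})"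
      using B1_has_deriv[OF assms, of "fst p"] p
      by (auto simp: has_vector_derivative_def Delta_iff)
    then have "(P has_derivative (\<lambda>h. h *\<^sub>R ideriv a b P (fst p))) (at (fst p) within fst ` Delta a b)"
      by (rule has_derivative_subset) (auto simp: Delta_def)
    from has_derivative_in_compose[OF has_derivative_fst[OF has_derivative_ident] this]
    show ?thesis by simp
  qed
  from Diff2_restr2[OF this]
  show "Diff2 (inx P)" "pdx a b (inx P) = inx (ideriv a b P)" "pdy a b (inx P) = 0"
    by (auto simp: inx_def restr2_def fun_eq_iff)
qed

lemma iny_deriv:
  assumes "P \<in> B1 a b"
  shows "Diff2 (iny P)" "pdx a b (iny P) = 0" "pdy a b (iny P) = iny (ideriv a b P)"
proof -
  have d: "((\<lambda>p. P (snd p)) has_derivative (\<lambda>h. fst h *\<^sub>R 0 + snd h *\<^sub>R ideriv a b P (snd p)))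
      (at p within Delta a b)" if p: "p \<in> Delta a b" for p
  proof -
    have "(P has_derivative (\<lambda>h. h *\<^sub>R ideriv a b P (snd p))) (at (snd p) within {a..b})"
      using B1_has_deriv[OF assms, of "snd p"] p
      by (auto simp: has_vector_derivative_def Delta_iff)
    then have "(P has_derivative (\<lambda>h. h *\<^sub>R ideriv a b P (snd p))) (at (snd p) within snd ` Delta a b)"
      by (rule has_derivative_subset) (auto simp: Delta_def)
    from has_derivative_in_compose[OF has_derivative_snd[OF has_derivative_ident] this]
    show ?thesis by simp
  qed
  from Diff2_restr2[OF this]
  show "Diff2 (iny P)" "pdx a b (iny P) = 0" "pdy a b (iny P) = iny (ideriv a b P)"
    by (auto simp: iny_def restr2_def fun_eq_iff)
qed

lemma inx_B2: 
  assumes "P \<in> B1 a b"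
  shows "inx P \<in> B2 a b"
proof -
  have "C2 n 0" for n
    using zero_B2 B2_iff_C2 by blast
  then have "C2 n (inx P)" if "P \<in> B1 a b" for n P
    using that
    by (induction n arbitrary: P) (simp_all only: C2.simps inx_deriv ideriv_B1 simp_thms)
  then show ?thesis
    using assms by (simp add: B2_iff_C2)
qed

lemma iny_B2: 
  assumes "P \<in> B1 a b"
  shows "iny P \<in> B2 a b"
proof -
  have "C2 n 0" for n
    using zero_B2 B2_iff_C2 by blast
  then have "C2 n (iny P)" if "P \<in> B1 a b" for n P
    using that
    by (induction n arbitrary: P) (simp_all only: C2.simps iny_deriv ideriv_B1 simp_thms)
  then show ?thesis
    using assms by (simp add: B2_iff_C2)
qed

lemma inx_times: "f \<in> B2 a b \<Longrightarrow> inx P * f = (\<lambda>(x, y). P x * f (x, y))"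
  by (auto simp: inx_def restr2_def fun_eq_iff B2_outside)

lemma iny_times: "f \<in> B2 a b \<Longrightarrow> iny P * f = (\<lambda>(x, y). P y * f (x, y))"
  by (auto simp: iny_def restr2_def fun_eq_iff B2_outside)

lemma B2_scale: 
  assumes "f \<in> B2 a b"
  shows "(\<lambda>z. c * f z) \<in> B2 a b"
proof -
  have "inx (restr (\<lambda>_. c)) * f = (\<lambda>z. c * f z)"
    using assms by (auto simp: inx_def restr2_def restr_def fun_eq_iff B2_outside) (auto simp: Delta_def)
  then show ?thesis
    using B2_mult[OF inx_B2[OF const_B1] assms, of c] by simp
qed

lemma B2_uminus: "f \<in> B2 a b \<Longrightarrow> - f \<in> B2 a b"
  using B2_scale[of f "-1"] by (simp add: fun_Compl_def)

text \<open>
  Chain rule along a curve in the triangle. It serves for the diagonal, for the horizontal and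
  vertical lines, and for the segments that parametrise the composition integral.
\<close>

lemma Diff2_curve:
  assumes f: "Diff2 f" and \<gamma>: "(\<gamma> has_vector_derivative \<gamma>') (at t within S)"
    and S: "\<gamma> ` S \<subseteq> Delta a b" "t \<in> S"
  shows "((\<lambda>t. f (\<gamma> t)) has_vector_derivative
    fst \<gamma>' *\<^sub>R pdx a b f (\<gamma> t) + snd \<gamma>' *\<^sub>R pdy a b f (\<gamma> t)) (at t within S)"
proof -
  have "(f has_derivative (\<lambda>h. fst h *\<^sub>R pdx a b f (\<gamma> t) + snd h *\<^sub>R pdy a b f (\<gamma> t)))
      (at (\<gamma> t) within \<gamma> ` S)"
    using Diff2_has_derivative[OF f] S by (blast intro: has_derivative_subset)
  from vector_derivative_diff_chain_within[OF \<gamma> this]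
  show ?thesis by (simp add: o_def)
qed

lemma Diff2_diag:
  assumes "Diff2 f"
  shows "Diff1 (diag f)" "ideriv a b (diag f) = diag (pdx a b f) + diag (pdy a b f)"
proof -
  have d: "(diag f has_vector_derivative pdx a b f (x, x) + pdy a b f (x, x)) (at x within {a..b})"
    if "x \<in> {a..b}" for x
  proof -
    have "((\<lambda>x. (x, x)) has_vector_derivative (1, 1)) (at x within {a..b})"
      by (auto intro!: derivative_eq_intros simp: has_vector_derivative_def)
    then show ?thesis
      using Diff2_curve[OF assms, of "\<lambda>x. (x, x)" "(1, 1)" x "{a..b}"] that ab
      by (simp add: diag_def Delta_def image_subset_iff)
  qed
  have z: "diag f x = 0" if "x \<notin> {a..b}" for x
    using assms that by (auto simp: diag_def Diff2_def Delta_def)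
  show "Diff1 (diag f)"
    by (rule Diff1I[OF z d])
  show "ideriv a b (diag f) = diag (pdx a b f) + diag (pdy a b f)"
    by (subst Diff1I(2)[OF z d]) (auto simp: fun_eq_iff restr_def diag_def pd_outside Delta_def)
qed

lemma diag_B1: "f \<in> B2 a b \<Longrightarrow> diag f \<in> B1 a b"
proof -
  have "C1 n (diag f)" if "f \<in> B2 a b" for n f
    using that
  proof (induction n arbitrary: f)
    case 0
    then show ?case
      unfolding C1.simps by (intro Diff2_diag B2_D)
  next
    case (Suc n)
    then show ?case
      unfolding C1.simps Diff2_diag(2)[OF B2_D(1)[OF Suc.prems]]
      by (intro conjI Diff2_diag C1_add Suc.IH B2_D)
  qed
  then show "f \<in> B2 a b \<Longrightarrow> diag f \<in> B1 a b"
    by (simp add: B1_iff_C1)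
qed

text \<open>
  Volterra operators are evaluated through the restriction of kernels to the lower side of the
  triangle.
\<close>

definition bottom :: "(real \<times> real \<Rightarrow> complex) \<Rightarrow> real \<Rightarrow> complex" where
  "bottom f = (\<lambda>x. f (x, a))"

lemma Diff2_bottom:
  assumes "Diff2 f"
  shows "Diff1 (bottom f)" "ideriv a b (bottom f) = bottom (pdx a b f)"
proof -
  have d: "(bottom f has_vector_derivative pdx a b f (x, a)) (at x within {a..b})"
    if "x \<in> {a..b}" for x
  proof -
    have "((\<lambda>x. (x, a)) has_vector_derivative (1, 0)) (at x within {a..b})"
      by (auto intro!: derivative_eq_intros simp: has_vector_derivative_def)
    then show ?thesis
      using Diff2_curve[OF assms, of "\<lambda>x. (x, a)" "(1, 0)" x "{a..b}"] that ab
      by (simp add: bottom_def Delta_def image_subset_iff)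
  qed
  have z: "bottom f x = 0" if "x \<notin> {a..b}" for x
    using assms that by (auto simp: bottom_def Diff2_def Delta_def)
  show "Diff1 (bottom f)"
    by (rule Diff1I[OF z d])
  show "ideriv a b (bottom f) = bottom (pdx a b f)"
    by (subst Diff1I(2)[OF z d]) (auto simp: fun_eq_iff restr_def bottom_def pd_outside Delta_def)
qed

lemma bottom_B1: "f \<in> B2 a b \<Longrightarrow> bottom f \<in> B1 a b"
proof -
  have "C1 n (bottom f)" if "f \<in> B2 a b" for n f
    using that
  proof (induction n arbitrary: f)
    case 0
    then show ?case
      unfolding C1.simps by (intro Diff2_bottom B2_D)
  next
    case (Suc n)
    then show ?case
      unfolding C1.simps Diff2_bottom(2)[OF B2_D(1)[OF Suc.prems]]
      by (intro conjI Diff2_bottom Suc.IH B2_D)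
  qed
  then show "f \<in> B2 a b \<Longrightarrow> bottom f \<in> B1 a b"
    by (simp add: B1_iff_C1)
qed

section \<open>The composition product of two kernels\<close>

text \<open>
  For \<open>p = (x, y)\<close>, the point at parameter \<open>s\<close> on the segment from \<open>y\<close> to \<open>x\<close>, over which the
  composition of two kernels integrates.
\<close>

definition seg :: "real \<times> real \<Rightarrow> real \<Rightarrow> real" where
  "seg p s = snd p + s * (fst p - snd p)"

lemma seg_Delta:
  assumes "p \<in> Delta a b" "s \<in> {0..1}"
  shows "(fst p, seg p s) \<in> Delta a b" "(seg p s, snd p) \<in> Delta a b"
proof -
  have "s * (fst p - snd p) \<le> 1 * (fst p - snd p)"
    by (rule mult_right_mono) (use assms in \<open>auto simp: Delta_iff\<close>)
  moreover have "0 \<le> s * (fst p - snd p)"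
    by (rule mult_nonneg_nonneg) (use assms in \<open>auto simp: Delta_iff\<close>)
  ultimately show "(fst p, seg p s) \<in> Delta a b" "(seg p s, snd p) \<in> Delta a b"
    using assms(1) by (auto simp: Delta_iff seg_def)
qed

lemma continuous_left_seg:
  assumes "continuous_on (Delta a b) F"
  shows "continuous_on (Delta a b \<times> {0..1}) (\<lambda>q. F (fst (fst q), seg (fst q) (snd q)))"
  by (rule continuous_on_compose2[OF assms])
    (auto simp: seg_def[abs_def] intro!: continuous_intros dest: seg_Delta)

lemma continuous_right_seg:
  assumes "continuous_on (Delta a b) F"
  shows "continuous_on (Delta a b \<times> {0..1}) (\<lambda>q. F (seg (fst q) (snd q), snd (fst q)))"
  by (rule continuous_on_compose2[OF assms])
    (auto simp: seg_def[abs_def] intro!: continuous_intros dest: seg_Delta)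

lemma integrable_seg:
  fixes k :: "real \<times> real \<Rightarrow> real \<Rightarrow> 'c::banach"
  assumes "continuous_on (Delta a b \<times> {0..1}) (\<lambda>q. k (fst q) (snd q))" "p \<in> Delta a b"
  shows "k p integrable_on {0..1::real}"
proof -
  have "continuous_on {0..1} (\<lambda>s. k (fst (p, s)) (snd (p, s)))"
    by (rule continuous_on_compose2[OF assms(1)]) (use assms(2) in \<open>auto intro!: continuous_intros\<close>)
  then show ?thesis
    by (simp add: integrable_continuous_real)
qed

text \<open>
  The integrand of \<open>conv a b f g p\<close> after the substitution \<open>z = seg p s\<close>. Its domain of
  integration \<open>{0..1}\<close> is the same for all \<open>p\<close>, so that Leibniz' rule applies on the triangle.
\<close>

definition integrand :: "(real \<times> real \<Rightarrow> complex) \<Rightarrow> (real \<times> real \<Rightarrow> complex) \<Rightarrow> real \<times> real \<Rightarrow> real \<Rightarrow> complex"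
  where "integrand f g p s = f (fst p, seg p s) * g (seg p s, snd p)"

lemma integrand_continuous:
  assumes "continuous_on (Delta a b) f" "continuous_on (Delta a b) g"
  shows "continuous_on (Delta a b \<times> {0..1}) (\<lambda>q. integrand f g (fst q) (snd q))"
  unfolding integrand_def
  by (intro continuous_on_mult continuous_left_seg continuous_right_seg assms)

lemma conv_eq_seg:
  assumes f: "continuous_on (Delta a b) f" and g: "continuous_on (Delta a b) g"
    and p: "p \<in> Delta a b"
  shows "conv a b f g p = (fst p - snd p) *\<^sub>R integral {0..1} (integrand f g p)"
proof (cases "fst p = snd p")
  case True
  then show ?thesis
    by (cases p) (simp add: conv_def)
next
  case False
  define x y where "x = fst p" and "y = snd p"
  have xy: "y < x" and pxy: "p = (x, y)"
    using False p by (auto simp: x_def y_def Delta_iff)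
  let ?F = "\<lambda>z. f (x, z) * g (z, y)"
  have "continuous_on {y..x} ?F"
    using p by (intro continuous_on_mult continuous_on_compose2[OF f] continuous_on_compose2[OF g] continuous_intros)
      (auto simp: pxy Delta_def)
  then have "(?F has_integral integral {y..x} ?F) (cbox y x)"
    by (simp add: integrable_continuous_real integrable_integral)
  from has_integral_affinity'[OF this, of "x - y" y] xy
  have "((\<lambda>s. ?F ((x - y) * s + y)) has_integral (integral {y..x} ?F /\<^sub>R (x - y))) {0..1}"
    by simp
  moreover have "?F ((x - y) * s + y) = integrand f g p s" for s
    by (simp add: integrand_def seg_def pxy algebra_simps)
  ultimately have "integral {0..1} (integrand f g p) = integral {y..x} ?F /\<^sub>R (x - y)"
    by (simp add: integral_unique)
  then show ?thesis
    using xy p by (simp add: conv_def pxy)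
qed

text \<open>
  Differentiating \<open>(x - y) * integral {0..1} (integrand f g p)\<close> under the integral sign gives, besides
  the kernels in which one factor is differentiated in its outer variable, terms in which the
  point \<open>z = seg p s\<close> moves. The latter involve the derivative of the integrand along the segment,
  weighted with \<open>s\<close> for the derivative in \<open>x\<close> and with \<open>1 - s\<close> for the derivative in \<open>y\<close>; integration by
  parts in \<open>s\<close> turns them into the boundary values at \<open>z = x\<close> and \<open>z = y\<close>.
\<close>

lemma conv_deriv:
  assumes f: "f \<in> B2 a b" and g: "g \<in> B2 a b"
  shows "Diff2 (conv a b f g)"
    "pdx a b (conv a b f g) = inx (diag f) * g + conv a b (pdx a b f) g"
    "pdy a b (conv a b f g) = - (iny (diag g) * f) + conv a b f (pdy a b g)"
proof -
  note cf = B2_continuous[OF f] B2_continuous[OF B2_D(2)[OF f]] B2_continuous[OF B2_D(3)[OF f]]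
  note cg = B2_continuous[OF g] B2_continuous[OF B2_D(2)[OF g]] B2_continuous[OF B2_D(3)[OF g]]
  \<comment> \<open>\<open>w\<close> is the derivative of the product \<open>f (x, z) * g (z, y)\<close> in the inner variable \<open>z\<close>.\<close>
  define w where "w p s = integrand (pdy a b f) g p s + integrand f (pdx a b g) p s" for p s
  define kx where "kx p s = integrand (pdx a b f) g p s + s *\<^sub>R w p s" for p s
  define ky where "ky p s = integrand f (pdy a b g) p s + (1 - s) *\<^sub>R w p s" for p s
  have cw: "continuous_on (Delta a b \<times> {0..1}) (\<lambda>q. w (fst q) (snd q))"
    unfolding w_def by (intro continuous_on_add integrand_continuous cf cg)
  have ckx: "continuous_on (Delta a b \<times> {0..1}) (\<lambda>q. kx (fst q) (snd q))"
    and cky: "continuous_on (Delta a b \<times> {0..1}) (\<lambda>q. ky (fst q) (snd q))"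
    unfolding kx_def ky_def by (intro continuous_intros integrand_continuous cw cf cg)+
  define L :: "real \<times> real \<Rightarrow> real \<Rightarrow> (real \<times> real) \<Rightarrow>\<^sub>L complex" where
    "L p s = (blinfun_scaleR_left (kx p s) o\<^sub>L fst_blinfun) + (blinfun_scaleR_left (ky p s) o\<^sub>L snd_blinfun)" for p s
  have L: "blinfun_apply (L p s) = (\<lambda>h. fst h *\<^sub>R kx p s + snd h *\<^sub>R ky p s)" for p s
    by (simp add: L_def blinfun.add_left fun_eq_iff)
  have cL: "continuous_on (Delta a b \<times> {0..1}) (\<lambda>q. L (fst q) (snd q))"
    unfolding L_def by (intro continuous_intros ckx cky)
  have integrand_deriv: "((\<lambda>p. integrand f g p s) has_derivative blinfun_apply (L p s)) (at p within Delta a b)"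
    if p: "p \<in> Delta a b" and s: "s \<in> cbox 0 1" for p s
  proof -
    have s': "s \<in> {0..1}" using s by simp
    let ?l = "\<lambda>p. (fst p, seg p s)" and ?r = "\<lambda>p. (seg p s, snd p)"
    let ?e = "\<lambda>h. snd h + s * (fst h - snd h)"
    have l1: "(?l has_derivative (\<lambda>h. (fst h, ?e h))) (at p within Delta a b)"
      unfolding seg_def by (auto intro!: derivative_eq_intros)
    have c1: "(f has_derivative (\<lambda>h. fst h *\<^sub>R pdx a b f (?l p) + snd h *\<^sub>R pdy a b f (?l p)))
        (at (?l p) within ?l ` Delta a b)"
      by (rule has_derivative_subset[OF B2_has_derivative[OF f seg_Delta(1)[OF p s']]])
        (use seg_Delta(1) s' in blast)
    have 1: "((\<lambda>p. f (?l p)) has_derivative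
        (\<lambda>h. fst h *\<^sub>R pdx a b f (?l p) + ?e h *\<^sub>R pdy a b f (?l p))) (at p within Delta a b)"
      by (rule has_derivative_eq_rhs[OF has_derivative_in_compose[OF l1 c1]]) (simp add: fun_eq_iff)
    have l2: "(?r has_derivative (\<lambda>h. (?e h, snd h))) (at p within Delta a b)"
      unfolding seg_def by (auto intro!: derivative_eq_intros)
    have c2: "(g has_derivative (\<lambda>h. fst h *\<^sub>R pdx a b g (?r p) + snd h *\<^sub>R pdy a b g (?r p)))
        (at (?r p) within ?r ` Delta a b)"
      by (rule has_derivative_subset[OF B2_has_derivative[OF g seg_Delta(2)[OF p s']]])
        (use seg_Delta(2) s' in blast)
    have 2: "((\<lambda>p. g (?r p)) has_derivative
        (\<lambda>h. ?e h *\<^sub>R pdx a b g (?r p) + snd h *\<^sub>R pdy a b g (?r p))) (at p within Delta a b)"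
      by (rule has_derivative_eq_rhs[OF has_derivative_in_compose[OF l2 c2]]) (simp add: fun_eq_iff)
    show ?thesis
      unfolding integrand_def L
      by (rule has_derivative_eq_rhs[OF has_derivative_mult[OF 1 2]])
        (simp add: fun_eq_iff kx_def ky_def w_def integrand_def scaleR_conv_of_real algebra_simps)
  qed
  have K: "((\<lambda>p. integral {0..1} (integrand f g p)) has_derivative
      (\<lambda>h. fst h *\<^sub>R integral {0..1} (kx p) + snd h *\<^sub>R integral {0..1} (ky p))) (at p within Delta a b)"
    if p: "p \<in> Delta a b" for p
  proof -
    have ckx': "kx p integrable_on {0..1}" and cky': "ky p integrable_on {0..1}"
      by (rule integrable_seg[OF ckx p], rule integrable_seg[OF cky p])
    have "((\<lambda>p. integral (cbox 0 1) (integrand f g p)) has_derivative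
        blinfun_apply (integral (cbox 0 1) (L p))) (at p within Delta a b)"
    proof (rule leibniz_rule[OF integrand_deriv _ _ p convex_Delta])
      show "integrand f g q integrable_on cbox 0 1" if "q \<in> Delta a b" for q
        using integrable_seg[OF integrand_continuous[OF cf(1) cg(1)] that] by simp
      show "continuous_on (Delta a b \<times> cbox 0 1) (\<lambda>(x, t). L x t)"
        using cL by (simp add: case_prod_beta)
    qed
    moreover have "blinfun_apply (integral (cbox 0 1) (L p)) h =
        fst h *\<^sub>R integral {0..1} (kx p) + snd h *\<^sub>R integral {0..1} (ky p)" for h
    proof -
      have "L p integrable_on cbox 0 1"
        using integrable_seg[OF cL p] by simp
      then have "blinfun_apply (integral (cbox 0 1) (L p)) h =
          integral {0..1} (\<lambda>s. fst h *\<^sub>R kx p s + snd h *\<^sub>R ky p s)"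
        by (simp add: blinfun_apply_integral L)
      also have "\<dots> = fst h *\<^sub>R integral {0..1} (kx p) + snd h *\<^sub>R integral {0..1} (ky p)"
        using ckx' cky' by (simp add: integral_add integrable_cmul)
      finally show ?thesis .
    qed
    ultimately show ?thesis
      by (simp add: has_derivative_eq_rhs[OF _ ext])
  qed
  have integrand_s: "(integrand f g p has_vector_derivative (fst p - snd p) *\<^sub>R w p s) (at s within {0..1})"
    if p: "p \<in> Delta a b" and s: "s \<in> {0..1}" for p s
  proof -
    have "((\<lambda>s. (fst p, seg p s)) has_vector_derivative (0, fst p - snd p)) (at s within {0..1})"
      "((\<lambda>s. (seg p s, snd p)) has_vector_derivative (fst p - snd p, 0)) (at s within {0..1})"
      unfolding seg_def has_vector_derivative_def by (auto intro!: derivative_eq_intros)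
    from Diff2_curve[OF B2_D(1)[OF f] this(1) _ s] Diff2_curve[OF B2_D(1)[OF g] this(2) _ s]
    have "((\<lambda>s. f (fst p, seg p s)) has_vector_derivative
        (fst p - snd p) *\<^sub>R pdy a b f (fst p, seg p s)) (at s within {0..1})"
      "((\<lambda>s. g (seg p s, snd p)) has_vector_derivative
        (fst p - snd p) *\<^sub>R pdx a b g (seg p s, snd p)) (at s within {0..1})"
      using seg_Delta[OF p] by (simp_all add: image_subset_iff)
    from has_vector_derivative_mult[OF this] show ?thesis
      by (simp add: integrand_def[abs_def] w_def algebra_simps)
  qed
  have by_parts: "(fst p - snd p) *\<^sub>R integral {0..1} (\<lambda>s. s *\<^sub>R w p s) + integral {0..1} (integrand f g p)
      = f (fst p, fst p) * g p"
    "(fst p - snd p) *\<^sub>R integral {0..1} (\<lambda>s. (1 - s) *\<^sub>R w p s) - integral {0..1} (integrand f g p)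
      = - (f p * g (snd p, snd p))" if p: "p \<in> Delta a b" for p
  proof -
    have "continuous_on (Delta a b \<times> {0..1}) (\<lambda>q. snd q *\<^sub>R w (fst q) (snd q))"
      "continuous_on (Delta a b \<times> {0..1}) (\<lambda>q. (1 - snd q) *\<^sub>R w (fst q) (snd q))"
      by (intro continuous_intros cw)+
    note i = integrable_seg[OF this(1) p] integrable_seg[OF this(2) p]
      integrable_seg[OF integrand_continuous[OF cf(1) cg(1)] p]
    have d1: "((\<lambda>s. s *\<^sub>R integrand f g p s) has_vector_derivative
        (fst p - snd p) *\<^sub>R (s *\<^sub>R w p s) + integrand f g p s) (at s within {0..1})" if "s \<in> {0..1}" for s
      by (rule has_vector_derivative_eq_rhs[OF has_vector_derivative_scaleR[OF DERIV_ident integrand_s[OF p that]]])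
        (simp add: scaleR_conv_of_real algebra_simps)
    have minus: "((\<lambda>s. 1 - s) has_field_derivative (-1::real)) (at s within {0..1})" for s
      by (auto intro!: derivative_eq_intros)
    have d2: "((\<lambda>s. (1 - s) *\<^sub>R integrand f g p s) has_vector_derivative
        (fst p - snd p) *\<^sub>R ((1 - s) *\<^sub>R w p s) - integrand f g p s) (at s within {0..1})" if "s \<in> {0..1}" for s
      by (rule has_vector_derivative_eq_rhs[OF has_vector_derivative_scaleR[OF minus integrand_s[OF p that]]])
        (simp add: scaleR_conv_of_real algebra_simps)
    have "((\<lambda>s. (fst p - snd p) *\<^sub>R (s *\<^sub>R w p s) + integrand f g p s) has_integral
        1 *\<^sub>R integrand f g p 1 - 0 *\<^sub>R integrand f g p 0) {0..1}"
      by (rule fundamental_theorem_of_calculus[OF zero_le_one d1])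
    moreover have "((\<lambda>s. (fst p - snd p) *\<^sub>R (s *\<^sub>R w p s) + integrand f g p s) has_integral
        (fst p - snd p) *\<^sub>R integral {0..1} (\<lambda>s. s *\<^sub>R w p s) + integral {0..1} (integrand f g p)) {0..1}"
      using i by (intro has_integral_add has_integral_cmul integrable_integral)
    ultimately show "(fst p - snd p) *\<^sub>R integral {0..1} (\<lambda>s. s *\<^sub>R w p s) + integral {0..1} (integrand f g p)
      = f (fst p, fst p) * g p"
      by (auto dest: has_integral_unique simp: integrand_def seg_def)
    have "((\<lambda>s. (fst p - snd p) *\<^sub>R ((1 - s) *\<^sub>R w p s) - integrand f g p s) has_integral
        (1 - 1) *\<^sub>R integrand f g p 1 - (1 - 0) *\<^sub>R integrand f g p 0) {0..1}"
      by (rule fundamental_theorem_of_calculus[OF zero_le_one d2])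
    moreover have "((\<lambda>s. (fst p - snd p) *\<^sub>R ((1 - s) *\<^sub>R w p s) - integrand f g p s) has_integral
        (fst p - snd p) *\<^sub>R integral {0..1} (\<lambda>s. (1 - s) *\<^sub>R w p s) - integral {0..1} (integrand f g p)) {0..1}"
      using i by (intro has_integral_diff has_integral_cmul integrable_integral)
    ultimately show "(fst p - snd p) *\<^sub>R integral {0..1} (\<lambda>s. (1 - s) *\<^sub>R w p s) - integral {0..1} (integrand f g p)
      = - (f p * g (snd p, snd p))"
      by (auto dest: has_integral_unique simp: integrand_def seg_def)
  qed
  have d: "(conv a b f g has_derivative (\<lambda>h.
      fst h *\<^sub>R (f (fst p, fst p) * g p + conv a b (pdx a b f) g p) +
      snd h *\<^sub>R (- (f p * g (snd p, snd p)) + conv a b f (pdy a b g) p))) (at p within Delta a b)"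
    if p: "p \<in> Delta a b" for p
  proof (rule has_derivative_transform[OF p conv_eq_seg[OF cf(1) cg(1)]])
    have "continuous_on (Delta a b \<times> {0..1}) (\<lambda>q. snd q *\<^sub>R w (fst q) (snd q))"
      "continuous_on (Delta a b \<times> {0..1}) (\<lambda>q. (1 - snd q) *\<^sub>R w (fst q) (snd q))"
      by (intro continuous_intros cw)+
    note i = integrable_seg[OF this(1) p] integrable_seg[OF this(2) p]
      integrable_seg[OF integrand_continuous[OF cf(2) cg(1)] p]
      integrable_seg[OF integrand_continuous[OF cf(1) cg(3)] p]
    have kx: "integral {0..1} (kx p) =
        integral {0..1} (integrand (pdx a b f) g p) + integral {0..1} (\<lambda>s. s *\<^sub>R w p s)"
      unfolding kx_def using i by (intro integral_add)
    have ky: "integral {0..1} (ky p) =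
        integral {0..1} (integrand f (pdy a b g) p) + integral {0..1} (\<lambda>s. (1 - s) *\<^sub>R w p s)"
      unfolding ky_def using i by (intro integral_add)
    have "((\<lambda>p. fst p - snd p) has_derivative (\<lambda>h. fst h - snd h)) (at p within Delta a b)"
      by (auto intro!: derivative_eq_intros)
    from has_derivative_scaleR[OF this K[OF p]]
    show "((\<lambda>p. (fst p - snd p) *\<^sub>R integral {0..1} (integrand f g p)) has_derivative (\<lambda>h.
      fst h *\<^sub>R (f (fst p, fst p) * g p + conv a b (pdx a b f) g p) +
      snd h *\<^sub>R (- (f p * g (snd p, snd p)) + conv a b f (pdy a b g) p))) (at p within Delta a b)"
      unfolding kx ky conv_eq_seg[OF cf(2) cg(1) p] conv_eq_seg[OF cf(1) cg(3) p]
        by_parts[OF p, symmetric]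
      by (rule has_derivative_eq_rhs) (simp add: fun_eq_iff scaleR_conv_of_real algebra_simps)
  qed
  have z: "conv a b f g p = 0" if "p \<notin> Delta a b" for p f g
    using that by (cases p) (simp add: conv_def)
  show "Diff2 (conv a b f g)"
    by (rule Diff2I[OF z d])
  show "pdx a b (conv a b f g) = inx (diag f) * g + conv a b (pdx a b f) g"
    by (subst Diff2I(2)[OF z d]) (simp_all add: fun_eq_iff restr2_def inx_def diag_def z)
  show "pdy a b (conv a b f g) = - (iny (diag g) * f) + conv a b f (pdy a b g)"
    by (subst Diff2I(3)[OF z d]) (simp_all add: fun_eq_iff restr2_def iny_def diag_def z)
qed

text \<open>
  The partial derivatives of a composition are products of smooth functions plus compositions of
  smooth kernels, so the induction on the order of differentiability goes through.
\<close>

lemma conv_B2: "f \<in> B2 a b \<Longrightarrow> g \<in> B2 a b \<Longrightarrow> conv a b f g \<in> B2 a b"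
proof -
  have B: "C2 n f" if "f \<in> B2 a b" for n f
    using that B2_iff_C2 by blast
  have "C2 n (conv a b f g)" if "f \<in> B2 a b" "g \<in> B2 a b" for n f g
    using that
  proof (induction n arbitrary: f g)
    case 0
    then show ?case
      unfolding C2.simps by (rule conv_deriv)
  next
    case (Suc n)
    then show ?case
      unfolding C2.simps conv_deriv(2,3)[OF Suc.prems]
      by (intro conjI conv_deriv C2_add Suc.IH B2_D B B2_uminus B2_mult inx_B2 iny_B2 diag_B1)
  qed
  then show "f \<in> B2 a b \<Longrightarrow> g \<in> B2 a b \<Longrightarrow> conv a b f g \<in> B2 a b"
    unfolding B2_iff_C2 by blast
qed

section \<open>Volterra operators\<close>

definition volterra :: "(real \<times> real \<Rightarrow> complex) \<Rightarrow> (real \<Rightarrow> complex) \<Rightarrow> real \<Rightarrow> complex" where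
  "volterra f \<phi> = restr (\<lambda>x. integral {a..x} (\<lambda>z. f (x, z) * \<phi> z))"

lemma continuous_row:
  assumes "f \<in> B2 a b" "x \<in> {a..b}"
  shows "continuous_on {a..x} (\<lambda>z. f (x, z))"
  by (rule continuous_on_compose2[OF B2_continuous[OF assms(1)]])
    (use assms(2) in \<open>auto simp: Delta_def intro!: continuous_intros\<close>)

lemma continuous_column:
  assumes "f \<in> B2 a b" "y \<in> {a..b}" "x \<le> b"
  shows "continuous_on {y..x} (\<lambda>z. f (z, y))"
  by (rule continuous_on_compose2[OF B2_continuous[OF assms(1)]])
    (use assms(2,3) in \<open>auto simp: Delta_def intro!: continuous_intros\<close>)

lemma B1_continuous_upto: "\<phi> \<in> B1 a b \<Longrightarrow> x \<le> b \<Longrightarrow> continuous_on {a..x} \<phi>"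
  by (rule continuous_on_subset[OF B1_continuous]) auto

lemma volterra_integrable:
  assumes "f \<in> B2 a b" "\<phi> \<in> B1 a b" "x \<in> {a..b}"
  shows "(\<lambda>z. f (x, z) * \<phi> z) integrable_on {a..x}"
  by (intro integrable_continuous_real continuous_on_mult continuous_row B1_continuous_upto)
    (use assms in auto)

text \<open>
  Applying a Volterra operator to \<open>\<phi>\<close> is composing its kernel with one that is constant in its
  second variable. Smoothness and the derivative of \<open>volterra f \<phi>\<close> are therefore special cases of the
  results on \<open>conv\<close>.
\<close>

lemma volterra_eq_conv: "volterra f \<phi> = bottom (conv a b f (inx \<phi>))"
proof
  fix x
  have "integral {a..x} (\<lambda>z. f (x, z) * \<phi> z) = integral {a..x} (\<lambda>z. f (x, z) * inx \<phi> (z, a))"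
    if "x \<in> {a..b}"
    by (rule integral_cong) (use that in \<open>auto simp: inx_def restr2_def Delta_def\<close>)
  then show "volterra f \<phi> x = bottom (conv a b f (inx \<phi>)) x"
    by (simp add: volterra_def bottom_def conv_def restr_def Delta_def)
qed

lemma volterra_B1: "f \<in> B2 a b \<Longrightarrow> \<phi> \<in> B1 a b \<Longrightarrow> volterra f \<phi> \<in> B1 a b"
  unfolding volterra_eq_conv by (intro bottom_B1 conv_B2 inx_B2)

lemma ideriv_volterra:
  assumes "f \<in> B2 a b" "\<phi> \<in> B1 a b"
  shows "ideriv a b (volterra f \<phi>) = diag f * \<phi> + volterra (pdx a b f) \<phi>"
proof -
  have "bottom (inx (diag f) * inx \<phi>) = diag f * \<phi>"
    using B1_outside[OF assms(2)] by (auto simp: bottom_def inx_def restr2_def Delta_def fun_eq_iff)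
  moreover have "bottom (g + h) = bottom g + bottom h" for g h
    by (auto simp: bottom_def fun_eq_iff)
  ultimately show ?thesis
    unfolding volterra_eq_conv Diff2_bottom(2)[OF conv_deriv(1)[OF assms(1) inx_B2[OF assms(2)]]]
      conv_deriv(2)[OF assms(1) inx_B2[OF assms(2)]] by presburger
qed

text \<open>
  The first derivative is \<open>diag f * \<phi>\<close>, which is flat, plus a Volterra operator applied to \<open>\<phi>\<close>
  again; so the derivatives at \<open>a\<close> vanish by induction over all kernels.
\<close>

lemma volterra_Mab:
  assumes "f \<in> B2 a b" "\<phi> \<in> Mab a b"
  shows "volterra f \<phi> \<in> Mab a b"
proof -
  have "(ideriv a b ^^ k) (volterra f \<phi>) a = 0" if "f \<in> B2 a b" for k f
    using that
  proof (induction k arbitrary: f)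
    case 0
    then show ?case
      using ab by (simp add: volterra_def)
  next
    case (Suc k)
    note \<phi> = Mab_B1[OF assms(2)]
    have "(ideriv a b ^^ Suc k) (volterra f \<phi>) a
        = (ideriv a b ^^ k) (diag f * \<phi>) a + (ideriv a b ^^ k) (volterra (pdx a b f) \<phi>) a"
      unfolding funpow_Suc_right o_apply ideriv_volterra[OF Suc.prems \<phi>]
        ideriv_pow_add[OF B1_mult[OF diag_B1[OF Suc.prems] \<phi>] volterra_B1[OF B2_D(2)[OF Suc.prems] \<phi>]]
      by (simp only: plus_fun_apply)
    also have "\<dots> = 0"
      using mult_Mab[OF diag_B1[OF Suc.prems] assms(2)] Suc.IH[OF B2_D(2)[OF Suc.prems]]
      unfolding Mab_def by simp
    finally show ?case .
  qed
  then show ?thesis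
    using assms volterra_B1 Mab_B1 unfolding Mab_def by blast
qed

lemma volterra_add_left:
  assumes "f \<in> B2 a b" "g \<in> B2 a b" "\<phi> \<in> B1 a b"
  shows "volterra (f + g) \<phi> = volterra f \<phi> + volterra g \<phi>"
proof
  fix x
  show "volterra (f + g) \<phi> x = (volterra f \<phi> + volterra g \<phi>) x"
    using integral_add[OF volterra_integrable[OF assms(1,3)] volterra_integrable[OF assms(2,3)], of x]
    by (simp add: volterra_def restr_def algebra_simps)
qed

lemma volterra_add_right:
  assumes "f \<in> B2 a b" "\<phi> \<in> B1 a b" "\<psi> \<in> B1 a b"
  shows "volterra f (\<phi> + \<psi>) = volterra f \<phi> + volterra f \<psi>"
proof
  fix x
  show "volterra f (\<phi> + \<psi>) x = (volterra f \<phi> + volterra f \<psi>) x"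
    using integral_add[OF volterra_integrable[OF assms(1,2)] volterra_integrable[OF assms(1,3)], of x]
    by (simp add: volterra_def restr_def algebra_simps)
qed

lemma volterra_scale_right: "volterra f (\<lambda>x. c * \<phi> x) = (\<lambda>x. c * volterra f \<phi> x)"
proof
  fix x
  show "volterra f (\<lambda>x. c * \<phi> x) x = c * volterra f \<phi> x"
    using integral_mult_right[of "{a..x}" c "\<lambda>z. f (x, z) * \<phi> z"]
    by (simp add: volterra_def restr_def algebra_simps)
qed

lemma volterra_scale_left: "volterra (\<lambda>z. c * f z) \<phi> = (\<lambda>x. c * volterra f \<phi> x)"
proof
  fix x
  show "volterra (\<lambda>z. c * f z) \<phi> x = c * volterra f \<phi> x"
    using integral_mult_right[of "{a..x}" c "\<lambda>z. f (x, z) * \<phi> z"]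
    by (simp add: volterra_def restr_def algebra_simps)
qed

lemma volterra_zero: "volterra 0 \<phi> = 0"
  by (auto simp: volterra_def restr_def fun_eq_iff)

lemma volterra_inx: "volterra (\<lambda>(x, y). P x * f (x, y)) \<phi> = P * volterra f \<phi>"
proof
  fix x
  show "volterra (\<lambda>(x, y). P x * f (x, y)) \<phi> x = (P * volterra f \<phi>) x"
    using integral_mult_right[of "{a..x}" "P x" "\<lambda>z. f (x, z) * \<phi> z"]
    by (simp add: volterra_def restr_def algebra_simps)
qed

lemma volterra_iny: "volterra (\<lambda>(x, y). Q y * f (x, y)) \<phi> = volterra f (Q * \<phi>)"
  by (auto simp: volterra_def restr_def fun_eq_iff algebra_simps)

text \<open>
  Integration by parts; the boundary term at \<open>a\<close> vanishes because \<open>\<phi> a = 0\<close>.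
\<close>

lemma volterra_ideriv:
  assumes f: "f \<in> B2 a b" and \<phi>: "\<phi> \<in> Mab a b"
  shows "volterra f (ideriv a b \<phi>) = diag f * \<phi> + volterra (- pdy a b f) \<phi>"
proof
  fix x
  note \<phi>' = Mab_B1[OF \<phi>]
  show "volterra f (ideriv a b \<phi>) x = (diag f * \<phi> + volterra (- pdy a b f) \<phi>) x"
  proof (cases "x \<in> {a..b}")
    case False
    then show ?thesis
      using B1_outside[OF \<phi>'] by (simp add: volterra_def)
  next
    case True
    have "((\<lambda>z. f (x, z) * \<phi> z) has_vector_derivative
        f (x, z) * ideriv a b \<phi> z + pdy a b f (x, z) * \<phi> z) (at z within {a..x})"
      if z: "z \<in> {a..x}" for z
    proof (rule has_vector_derivative_mult)
      have "((\<lambda>z. (x, z)) has_vector_derivative (0, 1)) (at z within {a..x})"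
        by (auto intro!: derivative_eq_intros simp: has_vector_derivative_def)
      then show "((\<lambda>z. f (x, z)) has_vector_derivative pdy a b f (x, z)) (at z within {a..x})"
        using Diff2_curve[OF B2_D(1)[OF f], of "\<lambda>z. (x, z)" "(0, 1)" z "{a..x}"] z True
        by (simp add: Delta_def image_subset_iff)
      show "(\<phi> has_vector_derivative ideriv a b \<phi> z) (at z within {a..x})"
        by (rule has_vector_derivative_within_subset[OF B1_has_deriv[OF \<phi>']]) (use z True in auto)
    qed
    then have "((\<lambda>z. f (x, z) * ideriv a b \<phi> z + pdy a b f (x, z) * \<phi> z) has_integral
        f (x, x) * \<phi> x - f (x, a) * \<phi> a) {a..x}"
      using True by (intro fundamental_theorem_of_calculus) auto
    then have "integral {a..x} (\<lambda>z. f (x, z) * ideriv a b \<phi> z) + integral {a..x} (\<lambda>z. pdy a b f (x, z) * \<phi> z)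
        = f (x, x) * \<phi> x"
      using integral_add[OF volterra_integrable[OF f ideriv_B1[OF \<phi>'] True] volterra_integrable[OF B2_D(3)[OF f] \<phi>' True]]
      by (simp add: integral_unique Mab_at[OF \<phi>])
    then show ?thesis
      using True by (simp add: volterra_def diag_def eq_diff_eq)
  qed
qed

lemma lebesgue_integral_interval:
  fixes h :: "real \<Rightarrow> complex"
  assumes "continuous_on {c..d} h"
  shows "(\<integral>y. indicator {c..d} y *\<^sub>R h y \<partial>lborel) = integral {c..d} h"
proof -
  have "set_integrable lborel {c..d} h"
    unfolding set_integrable_def by (rule borel_integrable_compact[OF compact_Icc assms])
  from set_borel_integral_eq_integral(2)[OF this] show ?thesis
    by (simp add: set_lebesgue_integral_def)
qed

text \<open>
  Both sides are iterated integrals of \<open>f (x, z) * g (z, y) * \<phi> y\<close> over the triangle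
  \<open>a \<le> y \<le> z \<le> x\<close>, taken in different orders.
\<close>

lemma volterra_conv:
  assumes f: "f \<in> B2 a b" and g: "g \<in> B2 a b" and \<phi>: "\<phi> \<in> B1 a b"
  shows "volterra (conv a b f g) \<phi> = volterra f (volterra g \<phi>)"
proof
  fix x
  show "volterra (conv a b f g) \<phi> x = volterra f (volterra g \<phi>) x"
  proof (cases "x \<in> {a..b}")
    case False
    then show ?thesis by (simp add: volterra_def)
  next
    case x: True
    define T where "T = {(z, y). a \<le> y \<and> y \<le> z \<and> z \<le> x}"
    define F where "F z y = indicator T (z, y) *\<^sub>R (f (x, z) * (g (z, y) * \<phi> y))" for z y
    have "T = cbox (a, a) (x, x) \<inter> {p. snd p \<le> fst p}"
      by (auto simp: T_def)
    then have "compact T"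
      by (simp add: compact_Int_closed closed_Collect_le continuous_on_fst continuous_on_snd)
    moreover have "continuous_on T (\<lambda>(z, y). f (x, z) * (g (z, y) * \<phi> y))"
      unfolding case_prod_beta
      by (intro continuous_on_mult continuous_on_compose2[OF B2_continuous[OF f]]
          continuous_on_compose2[OF B2_continuous[OF g]] continuous_on_compose2[OF B1_continuous[OF \<phi>]]
          continuous_intros) (use x in \<open>auto simp: T_def Delta_def\<close>)
    ultimately have "integrable lborel (\<lambda>p. indicator T p *\<^sub>R (case p of (z, y) \<Rightarrow> f (x, z) * (g (z, y) * \<phi> y)))"
      by (rule borel_integrable_compact)
    moreover have "case_prod F = (\<lambda>p. indicator T p *\<^sub>R (case p of (z, y) \<Rightarrow> f (x, z) * (g (z, y) * \<phi> y)))"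
      by (auto simp: F_def fun_eq_iff)
    ultimately have int: "integrable (lborel \<Otimes>\<^sub>M lborel) (case_prod F)"
      unfolding lborel_prod by (simp only:)
    have inner_y: "(\<integral>y. F z y \<partial>lborel) = indicator {a..x} z *\<^sub>R (f (x, z) * volterra g \<phi> z)" for z
    proof (cases "z \<in> {a..x}")
      case True
      have "(\<integral>y. F z y \<partial>lborel) = (\<integral>y. indicator {a..z} y *\<^sub>R (f (x, z) * (g (z, y) * \<phi> y)) \<partial>lborel)"
        using True by (intro Bochner_Integration.integral_cong) (auto simp: F_def T_def indicator_def)
      also have "\<dots> = integral {a..z} (\<lambda>y. f (x, z) * (g (z, y) * \<phi> y))"
        using True x
        by (intro lebesgue_integral_interval continuous_on_mult continuous_on_const continuous_row[OF g]
            B1_continuous_upto[OF \<phi>]) auto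
      also have "\<dots> = f (x, z) * volterra g \<phi> z"
        using True x by (simp add: volterra_def)
      finally show ?thesis
        using True by simp
    next
      case False
      then have "F z y = 0" for y
        by (auto simp: F_def T_def)
      then show ?thesis
        using False by simp
    qed
    have inner_z: "(\<integral>z. F z y \<partial>lborel) = indicator {a..x} y *\<^sub>R (conv a b f g (x, y) * \<phi> y)" for y
    proof (cases "y \<in> {a..x}")
      case True
      have "(\<integral>z. F z y \<partial>lborel) = (\<integral>z. indicator {y..x} z *\<^sub>R (f (x, z) * g (z, y) * \<phi> y) \<partial>lborel)"
        using True by (intro Bochner_Integration.integral_cong) (auto simp: F_def T_def indicator_def)
      also have "\<dots> = integral {y..x} (\<lambda>z. f (x, z) * g (z, y) * \<phi> y)"
        using True x
        by (intro lebesgue_integral_interval continuous_on_mult continuous_on_const continuous_column[OF g]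
            continuous_on_subset[OF continuous_row[OF f]]) auto
      also have "\<dots> = conv a b f g (x, y) * \<phi> y"
        using True x by (simp add: conv_def Delta_def)
      finally show ?thesis
        using True by simp
    next
      case False
      then have "F z y = 0" for z
        by (auto simp: F_def T_def)
      then show ?thesis
        using False by simp
    qed
    have "volterra (conv a b f g) \<phi> x = integral {a..x} (\<lambda>y. conv a b f g (x, y) * \<phi> y)"
      using x by (simp add: volterra_def)
    also have "\<dots> = (\<integral>y. \<integral>z. F z y \<partial>lborel \<partial>lborel)"
      unfolding inner_z using x
      by (intro lebesgue_integral_interval[symmetric] continuous_on_mult continuous_row[OF conv_B2[OF f g]]
          B1_continuous_upto[OF \<phi>]) auto
    also have "\<dots> = (\<integral>z. \<integral>y. F z y \<partial>lborel \<partial>lborel)"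
      by (rule lborel_pair.Fubini_integral[OF int])
    also have "\<dots> = integral {a..x} (\<lambda>z. f (x, z) * volterra g \<phi> z)"
      unfolding inner_y using x
      by (intro lebesgue_integral_interval continuous_on_mult continuous_row[OF f]
          B1_continuous_upto[OF volterra_B1[OF g \<phi>]]) auto
    also have "\<dots> = volterra f (volterra g \<phi>) x"
      using x by (simp add: volterra_def)
    finally show ?thesis .
  qed
qed

section \<open>Flat functions\<close>

text \<open>
  The functions \<open>q (1 / (x - a)) * exp (-1 / (x - a))\<close> with \<open>q\<close> a polynomial form a family closed under
  differentiation, each member tending to \<open>0\<close> at \<open>a\<close>. Allowing all \<open>q\<close> makes the proof that
  \<open>exp (-1 / (x - a))\<close> is smooth and flat a plain induction.
\<close>

definition flat0 :: "real poly \<Rightarrow> real \<Rightarrow> real" where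
  "flat0 q x = (if x > a then poly q (inverse (x - a)) * exp (- inverse (x - a)) else 0)"

definition flat :: "real poly \<Rightarrow> real \<Rightarrow> complex" where
  "flat q = restr (\<lambda>x. of_real (flat0 q x))"

text \<open>
  With \<open>u = 1 / (x - a)\<close>, the chain rule gives \<open>u\<^sup>2 (q u - q' u) exp (- u)\<close> as the derivative of
  \<open>q u * exp (- u)\<close>.
\<close>

definition flat_deriv :: "real poly \<Rightarrow> real poly" where
  "flat_deriv q = [:0, 0, 1:] * (q - pderiv q)"

lemma flat0_deriv:
  assumes "x \<in> {a..b}"
  shows "(flat0 q has_field_derivative flat0 (flat_deriv q) x) (at x within {a..b})"
proof (cases "x = a")
  case True
  have "filterlim (\<lambda>y. inverse (y - a)) at_top (at_right a)"
    by (subst filterlim_at_right_to_0) (simp add: filterlim_inverse_at_top_right)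
  \<comment> \<open>Dividing by \<open>y - a\<close> multiplies the polynomial by its variable, hence \<open>pCons 0 q\<close>.\<close>
  then have "((\<lambda>y. poly (pCons 0 q) (inverse (y - a)) * exp (- inverse (y - a))) \<longlongrightarrow> 0) (at_right a)"
    by (rule filterlim_compose[OF poly_div_exp_tendsto_0])
  moreover have "\<forall>\<^sub>F y in at_right a. poly (pCons 0 q) (inverse (y - a)) * exp (- inverse (y - a))
      = (flat0 q y - flat0 q a) / (y - a)"
    unfolding eventually_at_right_field
    by (rule exI[of _ "a + 1"]) (auto simp: flat0_def divide_simps)
  ultimately have "((\<lambda>y. (flat0 q y - flat0 q a) / (y - a)) \<longlongrightarrow> 0) (at_right a)"
    by (rule Lim_transform_eventually)
  then show ?thesis
    unfolding True has_field_derivative_iff at_within_Icc_at_right[OF ab] by (simp add: flat0_def)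
next
  case False
  then have x: "x > a" using assms by auto
  have "((\<lambda>x. poly q (inverse (x - a)) * exp (- inverse (x - a))) has_field_derivative flat0 (flat_deriv q) x) (at x)"
    using x by (auto intro!: derivative_eq_intros simp: flat0_def flat_deriv_def power2_eq_square algebra_simps)
  then have "(flat0 q has_field_derivative flat0 (flat_deriv q) x) (at x)"
    by (rule has_field_derivative_transform_within_open[of _ _ _ "{a<..}"]) (use x in \<open>auto simp: flat0_def\<close>)
  then show ?thesis
    by (rule has_field_derivative_at_within)
qed

lemma flat_deriv: "Diff1 (flat q)" "ideriv a b (flat q) = flat (flat_deriv q)"
proof -
  have "((\<lambda>x. of_real (flat0 q x) :: complex) has_vector_derivative of_real (flat0 (flat_deriv q) x)) (at x within {a..b})"
    if "x \<in> {a..b}" for x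
    using flat0_deriv[OF that, of q]
    by (intro bounded_linear.has_vector_derivative[OF bounded_linear_of_real])
      (simp add: has_real_derivative_iff_has_vector_derivative)
  from Diff1_restr[OF this]
  show "Diff1 (flat q)" "ideriv a b (flat q) = flat (flat_deriv q)"
    unfolding flat_def by blast+
qed

lemma flat_Mab: "flat q \<in> Mab a b"
proof -
  have "C1 n (flat q)" for n q
    by (induction n arbitrary: q) (simp_all only: C1.simps flat_deriv simp_thms)
  moreover have "(ideriv a b ^^ k) (flat q) a = 0" for k q
  proof (induction k arbitrary: q)
    case 0
    show ?case using ab by (simp add: flat_def flat0_def)
  next
    case (Suc k)
    show ?case unfolding funpow_Suc_right o_apply flat_deriv(2) by (rule Suc)
  qed
  ultimately show ?thesis
    by (simp add: Mab_def B1_iff_C1)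
qed

lemma flat_nonzero: "x \<in> {a<..b} \<Longrightarrow> flat 1 x \<noteq> 0"
  by (simp add: flat_def flat0_def)

section \<open>The operator of a formal sum\<close>

definition act :: "istar \<Rightarrow> (real \<Rightarrow> complex) \<Rightarrow> real \<Rightarrow> complex" where
  "act = (\<lambda>(p, f) \<phi>. (\<Sum>i | p i \<noteq> 0. p i * (ideriv a b ^^ i) \<phi>) + volterra f \<phi>)"

lemma shift_pow_apply: "(((*) (shift c) ^^ n) \<phi>) z = shift c z ^ n * \<phi> z"
  by (induction n) auto

lemma shift_pow_Mab: "\<phi> \<in> Mab a b \<Longrightarrow> ((*) (shift c) ^^ n) \<phi> \<in> Mab a b"
  by (induction n) (auto intro: mult_Mab shift_B1)

text \<open>
  The test function is \<open>(z - x) ^ N\<close> times a polynomial times a flat function, with \<open>N\<close> above the order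
  of the differential part, so that only the integral survives at \<open>x\<close>.
\<close>

lemma act_zero_kernel:
  assumes p: "finite {i. p i \<noteq> 0}" and f: "f \<in> B2 a b"
    and zero: "\<And>\<phi>. \<phi> \<in> Mab a b \<Longrightarrow> act (p, f) \<phi> = 0"
    and xz: "a < z" "z < x" "x \<le> b"
  shows "f (x, z) = 0"
proof -
  obtain N where N: "\<And>i. p i \<noteq> 0 \<Longrightarrow> i < N"
    using p unfolding finite_nat_set_iff_bounded by blast
  define u where "u z = f (x, z) * (shift x z ^ N * flat 1 z)" for z
  have x: "x \<in> {a..b}" using xz by simp
  have "u z = 0"
  proof (rule orthogonal_to_polynomials[of a x])
    show "continuous_on {a..x} u"
      unfolding u_def
      by (intro continuous_on_mult continuous_on_power continuous_row f x B1_continuous_upto shift_B1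
          Mab_B1 flat_Mab xz)
    show "integral {a..x} (\<lambda>z. u z * of_real (q z)) = 0" if q: "real_polynomial_function q" for q
    proof -
      define \<psi> where "\<psi> = restr (\<lambda>x. of_real (q x)) * flat 1"
      define \<phi> where "\<phi> = ((*) (shift x) ^^ N) \<psi>"
      have \<psi>: "\<psi> \<in> Mab a b"
        unfolding \<psi>_def by (intro mult_Mab polynomial_B1 q flat_Mab)
      have "act (p, f) \<phi> x = 0"
        using zero[OF shift_pow_Mab[OF \<psi>]] by (simp only: \<phi>_def zero_fun_apply)
      moreover have "(ideriv a b ^^ i) \<phi> x = 0" if "p i \<noteq> 0" for i
        unfolding \<phi>_def by (rule shift_pow_mult_jet(1)[OF Mab_B1[OF \<psi>] x N[OF that]])
      ultimately have "volterra f \<phi> x = 0"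
        by (simp add: act_def sum_fun_apply)
      moreover have "volterra f \<phi> x = integral {a..x} (\<lambda>z. u z * of_real (q z))"
        unfolding volterra_def restr_in[OF x]
        by (rule integral_cong) (use x in \<open>auto simp: \<phi>_def \<psi>_def shift_pow_apply u_def\<close>)
      ultimately show ?thesis by simp
    qed
  qed (use xz in auto)
  moreover have "shift x z \<noteq> 0" "flat 1 z \<noteq> 0"
    using xz flat_nonzero by (auto simp: shift_def)
  ultimately show ?thesis
    by (simp add: u_def)
qed

text \<open>
  Each point of the triangle is joined to a fixed interior point by a segment on which
  the function is known to vanish, and continuity carries this to the given point.
\<close>

lemma B2_zero_if_zero_inside:
  assumes f: "f \<in> B2 a b" and zero: "\<And>x z. a < z \<Longrightarrow> z < x \<Longrightarrow> x \<le> b \<Longrightarrow> f (x, z) = 0"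
  shows "f = 0"
proof -
  have "f p = 0" if p: "p \<in> Delta a b" for p
  proof -
    define m where "m = ((a + 2 * b) / 3, (2 * a + b) / 3)"
    define \<gamma> where "\<gamma> t = (1 - t) *\<^sub>R p + t *\<^sub>R m" for t :: real
    have m: "m \<in> Delta a b" "a < snd m" "snd m < fst m"
      using ab by (auto simp: m_def Delta_def)
    have \<gamma>: "\<gamma> t \<in> Delta a b" if "t \<in> {0..1}" for t
      using convexD_alt[OF convex_Delta p m(1)] that by (simp add: \<gamma>_def)
    have "continuous_on {0..1} (\<lambda>t. f (\<gamma> t))"
      by (rule continuous_on_compose2[OF B2_continuous[OF f]])
        (use \<gamma> in \<open>auto simp: \<gamma>_def intro!: continuous_intros\<close>)
    moreover have "f (\<gamma> t) = 0" if t: "t \<in> {0<..<1}" for t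
    proof -
      have "(1 - t) * a \<le> (1 - t) * snd p" "(1 - t) * snd p \<le> (1 - t) * fst p"
        using p t by (auto simp: Delta_iff intro!: mult_left_mono)
      moreover have "t * a < t * snd m" "t * snd m < t * fst m"
        using m t by auto
      ultimately have "a < snd (\<gamma> t)" "snd (\<gamma> t) < fst (\<gamma> t)"
        by (auto simp: \<gamma>_def algebra_simps)
      moreover have "fst (\<gamma> t) \<le> b"
        using \<gamma>[of t] t by (simp add: Delta_iff)
      ultimately show ?thesis
        using zero by (metis prod.collapse)
    qed
    moreover have "closure {0<..<1::real} = {0..1}"
      by simp
    ultimately have "f (\<gamma> 0) = 0"
      using continuous_constant_on_closure[of "{0<..<1}" "\<lambda>t. f (\<gamma> t)" 0 0] by simp
    then show ?thesis
      by (simp add: \<gamma>_def)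
  qed
  then show ?thesis
    using B2_outside[OF f] by (metis ext zero_fun_apply)
qed

text \<open>
  For the leading index \<open>n\<close>, the test function \<open>(z - x) ^ n\<close> times a flat function has a vanishing
  derivative of each lower order at \<open>x\<close>, so that \<open>p n x\<close> alone is multiplied by a nonzero number.
\<close>

lemma act_zero_coeff:
  assumes p: "finite {i. p i \<noteq> 0}" and B: "\<And>i. p i \<in> B1 a b"
    and zero: "\<And>\<phi>. \<phi> \<in> Mab a b \<Longrightarrow> act (p, 0) \<phi> = 0"
  shows "p = 0"
proof (rule ccontr)
  assume "p \<noteq> 0"
  then have ne: "{i. p i \<noteq> 0} \<noteq> {}"
    by (auto simp: fun_eq_iff)
  define n where "n = Max {i. p i \<noteq> 0}"
  have n: "p n \<noteq> 0" and le: "\<And>i. p i \<noteq> 0 \<Longrightarrow> i \<le> n"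
    using Max_in[OF p ne] Max_ge[OF p] by (auto simp: n_def)
  have inside: "p n x = 0" if x: "x \<in> {a<..b}" for x
  proof -
    have x': "x \<in> {a..b}" using x by simp
    let ?\<phi> = "((*) (shift x) ^^ n) (flat 1)"
    have jet: "p i x * (ideriv a b ^^ i) ?\<phi> x = (if i = n then p n x * (fact n * flat 1 x) else 0)"
      if "p i \<noteq> 0" for i
      using shift_pow_mult_jet[OF Mab_B1[OF flat_Mab] x'] le[OF that] by (cases "i = n") auto
    have "0 = act (p, 0) ?\<phi> x"
      using zero[OF shift_pow_Mab[OF flat_Mab]] by (simp only: zero_fun_apply)
    also have "\<dots> = (\<Sum>i | p i \<noteq> 0. p i x * (ideriv a b ^^ i) ?\<phi> x)"
      by (simp add: act_def sum_fun_apply volterra_zero)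
    also have "\<dots> = (\<Sum>i | p i \<noteq> 0. if i = n then p n x * (fact n * flat 1 x) else 0)"
      by (rule sum.cong) (use jet in auto)
    also have "\<dots> = p n x * (fact n * flat 1 x)"
      using p n by (simp add: sum.delta)
    finally show ?thesis
      using flat_nonzero[OF x] by simp
  qed
  have "p n x = 0" for x
  proof (cases "x \<in> {a..b}")
    case True
    have "closure {a<..<b} = {a..b}"
      using ab by simp
    then show ?thesis
      using continuous_constant_on_closure[of "{a<..<b}" "p n" 0 x] B1_continuous[OF B] inside True
      by simp
  next
    case False
    then show ?thesis using B1_outside[OF B] by blast
  qed
  then show False
    using n by (simp add: fun_eq_iff)
qed

section \<open>Endomorphisms of the space of flat functions\<close>

abbreviation Formal :: "istar set" where
  "Formal \<equiv> carrier (I_star a b)"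

definition Phi :: "istar \<Rightarrow> (real \<Rightarrow> complex) \<Rightarrow> real \<Rightarrow> complex" where
  "Phi U = on_M a b (act U)"

lemma End_M_ops:
  "S \<otimes>\<^bsub>End_M a b\<^esub> T = S \<circ> T" "S \<oplus>\<^bsub>End_M a b\<^esub> T = S + T" "c \<odot>\<^bsub>End_M a b\<^esub> T = (\<lambda>\<phi> x. c * T \<phi> x)"
  "\<one>\<^bsub>End_M a b\<^esub> = on_M a b id" "\<zero>\<^bsub>End_M a b\<^esub> = 0"
  by (simp_all add: End_M_def)

lemma End_M_I:
  assumes "\<And>\<phi>. \<phi> \<in> Mab a b \<Longrightarrow> T \<phi> \<in> Mab a b" "\<And>\<phi>. \<phi> \<notin> Mab a b \<Longrightarrow> T \<phi> = 0"
    "\<And>\<phi> \<psi>. \<phi> \<in> Mab a b \<Longrightarrow> \<psi> \<in> Mab a b \<Longrightarrow> T (\<phi> + \<psi>) = T \<phi> + T \<psi>"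
    "\<And>c \<phi>. \<phi> \<in> Mab a b \<Longrightarrow> T (\<lambda>x. c * \<phi> x) = (\<lambda>x. c * T \<phi> x)"
  shows "T \<in> carrier (End_M a b)"
  using assms unfolding End_M_def partial_object.select_convs mem_Collect_eq by blast

lemma End_M_D:
  assumes "T \<in> carrier (End_M a b)"
  shows "\<phi> \<in> Mab a b \<Longrightarrow> T \<phi> \<in> Mab a b" "\<phi> \<notin> Mab a b \<Longrightarrow> T \<phi> = 0"
    "\<phi> \<in> Mab a b \<Longrightarrow> \<psi> \<in> Mab a b \<Longrightarrow> T (\<phi> + \<psi>) = T \<phi> + T \<psi>"
    "\<phi> \<in> Mab a b \<Longrightarrow> T (\<lambda>x. c * \<phi> x) = (\<lambda>x. c * T \<phi> x)"
  using assms unfolding End_M_def partial_object.select_convs mem_Collect_eq by blast+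

lemma End_M_zero:
  assumes "T \<in> carrier (End_M a b)"
  shows "T 0 = 0"
proof -
  have "T (0 + 0) = T 0 + T 0"
    by (rule End_M_D(3)[OF assms zero_Mab zero_Mab])
  then show ?thesis
    by (simp only: add_0_left add_cancel_right_right)
qed

lemma End_M_in_Mab: "T \<in> carrier (End_M a b) \<Longrightarrow> T \<phi> \<in> Mab a b"
  by (cases "\<phi> \<in> Mab a b") (simp_all only: End_M_D zero_Mab not_False_eq_True)

lemma End_M_eqI:
  assumes "S \<in> carrier (End_M a b)" "T \<in> carrier (End_M a b)" "\<And>\<phi>. \<phi> \<in> Mab a b \<Longrightarrow> S \<phi> = T \<phi>"
  shows "S = T"
proof
  show "S \<phi> = T \<phi>" for \<phi>
    by (cases "\<phi> \<in> Mab a b") (simp_all only: assms(3) End_M_D(2)[OF assms(1)] End_M_D(2)[OF assms(2)] not_False_eq_True)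
qed

lemma End_M_closed:
  shows "S \<in> carrier (End_M a b) \<Longrightarrow> T \<in> carrier (End_M a b) \<Longrightarrow> S \<circ> T \<in> carrier (End_M a b)"
    and "S \<in> carrier (End_M a b) \<Longrightarrow> T \<in> carrier (End_M a b) \<Longrightarrow> S + T \<in> carrier (End_M a b)"
    and "S \<in> carrier (End_M a b) \<Longrightarrow> (\<lambda>\<phi> x. c * S \<phi> x) \<in> carrier (End_M a b)"
    and "on_M a b id \<in> carrier (End_M a b)" and "0 \<in> carrier (End_M a b)"
proof -
  show "S \<circ> T \<in> carrier (End_M a b)"
    if S: "S \<in> carrier (End_M a b)" and T: "T \<in> carrier (End_M a b)"
    by (rule End_M_I)
      (simp_all only: o_apply End_M_D[OF T] End_M_zero[OF S] End_M_in_Mab[OF S] End_M_in_Mab[OF T] End_M_D(3,4)[OF S]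
        not_False_eq_True)
  show "S + T \<in> carrier (End_M a b)"
    if S: "S \<in> carrier (End_M a b)" and T: "T \<in> carrier (End_M a b)"
  proof (rule End_M_I)
    show "(S + T) (\<phi> + \<psi>) = (S + T) \<phi> + (S + T) \<psi>" if "\<phi> \<in> Mab a b" "\<psi> \<in> Mab a b" for \<phi> \<psi>
      unfolding plus_fun_apply[of S T] End_M_D(3)[OF S that] End_M_D(3)[OF T that]
      by (simp only: ac_simps)
    show "(S + T) (\<lambda>x. c * \<phi> x) = (\<lambda>x. c * (S + T) \<phi> x)" if "\<phi> \<in> Mab a b" for c \<phi>
      unfolding plus_fun_apply[of S T] End_M_D(4)[OF S that] End_M_D(4)[OF T that]
      by (rule ext) (simp add: distrib_left)
  qed (simp_all only: plus_fun_apply[of S T] End_M_D[OF S] End_M_D[OF T] add_Mab add_0_left not_False_eq_True)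
  show "(\<lambda>\<phi> x. c * S \<phi> x) \<in> carrier (End_M a b)" if S: "S \<in> carrier (End_M a b)"
  proof (rule End_M_I)
    show "(\<lambda>x. c * S \<phi> x) = 0" if "\<phi> \<notin> Mab a b" for \<phi>
      unfolding End_M_D(2)[OF S that] by (rule ext) simp
    show "(\<lambda>x. c * S (\<phi> + \<psi>) x) = (\<lambda>x. c * S \<phi> x) + (\<lambda>x. c * S \<psi> x)" if "\<phi> \<in> Mab a b" "\<psi> \<in> Mab a b" for \<phi> \<psi>
      unfolding End_M_D(3)[OF S that] by (rule ext) (simp add: distrib_left)
    show "(\<lambda>x. c * S (\<lambda>x. d * \<phi> x) x) = (\<lambda>x. d * (c * S \<phi> x))" if "\<phi> \<in> Mab a b" for d \<phi>
      unfolding End_M_D(4)[OF S that] by (rule ext) simp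
  qed (intro scale_Mab End_M_in_Mab S)
  show "on_M a b id \<in> carrier (End_M a b)"
    by (rule End_M_I) (simp_all add: on_M_def add_Mab scale_Mab)
  show "0 \<in> carrier (End_M a b)"
    by (rule End_M_I) (auto simp: zero_Mab fun_eq_iff)
qed

lemma End_M_algebra: "complex_algebra (End_M a b)"
proof (rule complex_algebraI; unfold End_M_ops)
  let ?E = "carrier (End_M a b)"
  show "U \<circ> (S + T) = (U \<circ> S) + (U \<circ> T)" if "S \<in> ?E" "T \<in> ?E" "U \<in> ?E" for S T U
    by (rule ext) (simp only: o_apply plus_fun_apply[of S T] plus_fun_apply[of "U \<circ> S" "U \<circ> T"]
      End_M_D(3)[OF that(3)] End_M_in_Mab[OF that(1)] End_M_in_Mab[OF that(2)])
  show "S \<circ> (\<lambda>\<phi> x. c * T \<phi> x) = (\<lambda>\<phi> x. c * (S \<circ> T) \<phi> x)" if "S \<in> ?E" "T \<in> ?E" for c S T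
    by (rule ext) (simp only: o_apply End_M_D(4)[OF that(1)] End_M_in_Mab[OF that(2)])
  show "on_M a b id \<circ> S = S" if "S \<in> ?E" for S
    by (rule ext) (simp only: o_apply on_M_def End_M_in_Mab[OF that] if_True id_apply)
  show "S \<circ> on_M a b id = S" if "S \<in> ?E" for S
  proof
    show "(S \<circ> on_M a b id) \<phi> = S \<phi>" for \<phi>
      using End_M_D(2)[OF that, of \<phi>] End_M_zero[OF that]
      by (cases "\<phi> \<in> Mab a b") (simp_all only: o_apply on_M_def if_True if_False id_apply not_False_eq_True)
  qed
qed (auto intro: End_M_closed simp: fun_eq_iff algebra_simps)

section \<open>The action of formal sums on flat functions\<close>

abbreviation D where "D \<equiv> ideriv a b"

lemma FormalI: "(\<And>i. p i \<in> B1 a b) \<Longrightarrow> finite {i. p i \<noteq> 0} \<Longrightarrow> f \<in> B2 a b \<Longrightarrow> (p, f) \<in> Formal"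
  by (simp add: I_star_def)

lemma FormalD:
  assumes "(p, f) \<in> Formal"
  shows "p i \<in> B1 a b" "finite {i. p i \<noteq> 0}" "f \<in> B2 a b"
  using assms by (simp_all add: I_star_def)

lemma Formal_supp:
  assumes "(p, f) \<in> Formal"
  obtains N where "\<And>i. N \<le> i \<Longrightarrow> p i = 0"
  using FormalD(2)[OF assms] unfolding finite_nat_set_iff_bounded
  by (metis (mono_tags, lifting) linorder_not_le mem_Collect_eq)

lemma act_pair: "act (p, f) \<phi> = (\<Sum>i | p i \<noteq> 0. p i * (D ^^ i) \<phi>) + volterra f \<phi>"
  by (simp only: act_def prod.case)

text \<open>
  Sums over the supports of coefficient sequences become comparable once they are all extended to a
  common initial segment of the indices.
\<close>

lemma act_eq:
  assumes "\<And>i. N \<le> i \<Longrightarrow> p i = 0"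
  shows "act (p, f) \<phi> = (\<Sum>i<N. p i * (D ^^ i) \<phi>) + volterra f \<phi>"
proof -
  have "(\<Sum>i | p i \<noteq> 0. p i * (D ^^ i) \<phi>) = (\<Sum>i<N. p i * (D ^^ i) \<phi>)"
  proof (rule sum.mono_neutral_left)
    show "{i. p i \<noteq> 0} \<subseteq> {..<N}"
      using assms by (metis (mono_tags, lifting) lessThan_iff linorder_not_le mem_Collect_eq subsetI)
    show "\<forall>i\<in>{..<N} - {i. p i \<noteq> 0}. p i * (D ^^ i) \<phi> = 0"
      by (metis (mono_tags, lifting) DiffD2 mem_Collect_eq mult_zero_left)
  qed simp
  then show ?thesis
    by (simp only: act_pair)
qed

lemma sum_B1: "(\<And>i. i \<in> I \<Longrightarrow> F i \<in> B1 a b) \<Longrightarrow> sum F I \<in> B1 a b"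
  by (induction I rule: infinite_finite_induct) (simp_all add: zero_B1 B1_add)

lemma sum_Mab: "(\<And>i. i \<in> I \<Longrightarrow> F i \<in> Mab a b) \<Longrightarrow> sum F I \<in> Mab a b"
  by (induction I rule: infinite_finite_induct) (simp_all add: zero_Mab add_Mab)

lemma ideriv_sum:
  assumes "\<And>i. i \<in> I \<Longrightarrow> F i \<in> B1 a b"
  shows "D (sum F I) = (\<Sum>i\<in>I. D (F i))"
  using assms
  by (induction I rule: infinite_finite_induct)
    (simp_all only: sum.infinite sum.empty ideriv_zero[OF ab] sum.insert not_False_eq_True insert_iff
      simp_thms ideriv_add sum_B1)

lemma volterra_zero_right: "volterra f 0 = 0"
  by (rule ext) (simp add: volterra_def restr_def)

lemma volterra_sum_right:
  assumes f: "f \<in> B2 a b" and "\<And>i. i \<in> I \<Longrightarrow> F i \<in> B1 a b"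
  shows "volterra f (sum F I) = (\<Sum>i\<in>I. volterra f (F i))"
  using assms(2)
  by (induction I rule: infinite_finite_induct)
    (simp_all only: sum.infinite sum.empty volterra_zero_right sum.insert not_False_eq_True insert_iff
      simp_thms volterra_add_right[OF f] sum_B1)

lemma act_Mab:
  assumes "U \<in> Formal" "\<phi> \<in> Mab a b"
  shows "act U \<phi> \<in> Mab a b"
proof -
  obtain p f where U: "U = (p, f)" by fastforce
  note F = FormalD[OF assms(1)[unfolded U]]
  show ?thesis
    unfolding U act_def prod.case
    by (intro add_Mab sum_Mab mult_Mab F ideriv_pow_Mab volterra_Mab assms)
qed

lemma act_add_right:
  assumes "U \<in> Formal" "\<phi> \<in> Mab a b" "\<psi> \<in> Mab a b"
  shows "act U (\<phi> + \<psi>) = act U \<phi> + act U \<psi>"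
proof -
  obtain p f where U: "U = (p, f)" by fastforce
  note F = FormalD[OF assms(1)[unfolded U]]
  note B = assms(2,3)[THEN Mab_B1]
  show ?thesis
    unfolding U act_def prod.case ideriv_pow_add[OF B] volterra_add_right[OF F(3) B]
    by (simp only: distrib_left sum.distrib ac_simps)
qed

lemma act_scale_right:
  assumes "\<phi> \<in> Mab a b"
  shows "act U (\<lambda>x. c * \<phi> x) = (\<lambda>x. c * act U \<phi> x)"
proof -
  obtain p f where U: "U = (p, f)" by fastforce
  show ?thesis
    unfolding U act_def prod.case ideriv_pow_scale[OF Mab_B1[OF assms]] volterra_scale_right
    by (rule ext) (simp add: sum_fun_apply sum_distrib_left algebra_simps)
qed

lemma Formal_add:
  assumes "(p, f) \<in> Formal" "(q, g) \<in> Formal"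
  shows "(p, f) + (q, g) \<in> Formal"
proof -
  have "finite {i. (p + q) i \<noteq> 0}"
    by (rule finite_subset[of _ "{i. p i \<noteq> 0} \<union> {i. q i \<noteq> 0}"])
      (use FormalD(2)[OF assms(1)] FormalD(2)[OF assms(2)] in auto)
  then show ?thesis
    unfolding add_Pair using assms
    by (intro FormalI) (simp_all only: plus_fun_apply[of p q] B1_add B2_add FormalD)
qed

lemma act_add_left:
  assumes "U \<in> Formal" "W \<in> Formal" "\<phi> \<in> Mab a b"
  shows "act (U + W) \<phi> = act U \<phi> + act W \<phi>"
proof -
  obtain p f q g where UW: "U = (p, f)" "W = (q, g)" by fastforce
  obtain N M where N: "\<And>i. N \<le> i \<Longrightarrow> p i = 0" and M: "\<And>i. M \<le> i \<Longrightarrow> q i = 0"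
    using Formal_supp assms UW by metis
  have "act (U + W) \<phi> = (\<Sum>i<max N M. (p + q) i * (D ^^ i) \<phi>) + volterra (f + g) \<phi>"
    unfolding UW add_Pair by (rule act_eq) (simp only: plus_fun_apply[of p q] N M max.bounded_iff add_0_left)
  also have "\<dots> = act (p, f) \<phi> + act (q, g) \<phi>"
    unfolding plus_fun_apply[of p q] distrib_right sum.distrib
      volterra_add_left[OF FormalD(3)[OF assms(1)[unfolded UW]] FormalD(3)[OF assms(2)[unfolded UW]] Mab_B1[OF assms(3)]]
    by (subst act_eq[of "max N M" p], simp only: N max.bounded_iff,
        subst act_eq[of "max N M" q], simp only: M max.bounded_iff) (simp only: ac_simps)
  finally show ?thesis
    unfolding UW .
qed

lemma act_zero_left: "act 0 \<phi> = 0"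
  unfolding zero_prod_def act_def prod.case volterra_zero by (rule ext) (simp add: sum_fun_apply)

lemma zero_Formal: "0 \<in> Formal"
  unfolding zero_prod_def by (intro FormalI) (simp_all add: zero_B1 zero_B2)

lemma Formal_plus: "U \<in> Formal \<Longrightarrow> W \<in> Formal \<Longrightarrow> U + W \<in> Formal"
  by (metis Formal_add surj_pair)

lemma Formal_sum: "(\<And>i. i \<in> I \<Longrightarrow> F i \<in> Formal) \<Longrightarrow> sum F I \<in> Formal"
  by (induction I rule: infinite_finite_induct) (simp_all add: zero_Formal Formal_plus)

lemma act_sum_left:
  assumes "\<And>i. i \<in> I \<Longrightarrow> F i \<in> Formal" "\<phi> \<in> Mab a b"
  shows "act (sum F I) \<phi> = (\<Sum>i\<in>I. act (F i) \<phi>)"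
  using assms(1)
  by (induction I rule: infinite_finite_induct)
    (simp_all only: sum.infinite sum.empty act_zero_left sum.insert not_False_eq_True insert_iff
      simp_thms act_add_left[OF _ _ assms(2)] Formal_sum)

lemma theta_Formal: "f \<in> B2 a b \<Longrightarrow> theta f \<in> Formal"
  unfolding theta_def by (intro FormalI) (simp_all add: zero_B1)

lemma act_theta: "act (theta f) \<phi> = volterra f \<phi>"
  unfolding theta_def by (subst act_eq[of 0]) simp_all

lemma beta_Formal: "P \<in> B1 a b \<Longrightarrow> beta P n \<in> Formal"
  unfolding beta_def by (intro FormalI) (simp_all add: zero_B1 zero_B2)

lemma act_beta: "act (beta P n) \<phi> = P * (D ^^ n) \<phi>"
  unfolding beta_def
  by (subst act_eq[of "Suc n"]) (auto simp: volterra_zero if_distrib[of "\<lambda>u. u * _"] sum.delta fun_eq_iff cong: if_cong)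

lemma lmul_Formal:
  assumes "P \<in> B1 a b" "U \<in> Formal"
  shows "lmul P U \<in> Formal"
proof -
  obtain p f where U: "U = (p, f)" by fastforce
  note F = FormalD[OF assms(2)[unfolded U]]
  have "finite {k. P * p k \<noteq> 0}"
    by (rule finite_subset[OF _ F(2)]) auto
  moreover have "(\<lambda>(x, y). P x * f (x, y)) \<in> B2 a b"
    using B2_mult[OF inx_B2[OF assms(1)] F(3)] unfolding inx_times[OF F(3)] .
  ultimately show ?thesis
    unfolding U lmul_def prod.case using assms(1) F by (intro FormalI B1_mult)
qed

lemma act_lmul:
  assumes "U \<in> Formal"
  shows "act (lmul P U) \<phi> = P * act U \<phi>"
proof -
  obtain p f where U: "U = (p, f)" by fastforce
  obtain N where N: "\<And>i. N \<le> i \<Longrightarrow> p i = 0"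
    using Formal_supp assms U by metis
  have actU: "act (p, f) \<psi> = (\<Sum>i<N. p i * (D ^^ i) \<psi>) + volterra f \<psi>" for \<psi>
    by (rule act_eq) (rule N)
  have "act (lmul P U) \<phi> = (\<Sum>i<N. P * p i * (D ^^ i) \<phi>) + volterra (\<lambda>(x, y). P x * f (x, y)) \<phi>"
    unfolding U lmul_def prod.case by (rule act_eq) (simp only: N mult_zero_right)
  also have "\<dots> = P * act U \<phi>"
    unfolding U volterra_inx actU by (simp only: distrib_left sum_distrib_left mult.assoc)
  finally show ?thesis .
qed

lemma rder_Formal:
  assumes "U \<in> Formal"
  shows "rder a b U \<in> Formal"
proof -
  obtain p f where U: "U = (p, f)" by fastforce
  note F = FormalD[OF assms[unfolded U]]
  have "finite {k. (if k = 0 then diag f else p (k - 1)) \<noteq> 0}"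
  proof (rule finite_subset)
    show "{k. (if k = 0 then diag f else p (k - 1)) \<noteq> 0} \<subseteq> insert 0 (Suc ` {i. p i \<noteq> 0})"
    proof
      show "k \<in> insert 0 (Suc ` {i. p i \<noteq> 0})" if "k \<in> {k. (if k = 0 then diag f else p (k - 1)) \<noteq> 0}" for k
        using that by (cases k) auto
    qed
  qed (use F(2) in simp)
  then show ?thesis
    unfolding U rder_def prod.case using F
    by (intro FormalI) (auto intro: diag_B1 B2_uminus B2_D)
qed

text \<open>
  Right multiplication by \<open>\<partial>\<^sub>x\<close> precomposes the operator with differentiation: the coefficients move
  up by one index, and integration by parts accounts for the kernel.
\<close>

lemma act_rder:
  assumes "U \<in> Formal" "\<phi> \<in> Mab a b"
  shows "act (rder a b U) \<phi> = act U (D \<phi>)"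
proof -
  obtain p f where U: "U = (p, f)" by fastforce
  note F = FormalD[OF assms(1)[unfolded U]]
  obtain N where N: "\<And>i. N \<le> i \<Longrightarrow> p i = 0"
    using Formal_supp assms U by metis
  have actU: "act (p, f) \<psi> = (\<Sum>i<N. p i * (D ^^ i) \<psi>) + volterra f \<psi>" for \<psi>
    by (rule act_eq) (rule N)
  have "act (rder a b U) \<phi> = (\<Sum>i<Suc N. (if i = 0 then diag f else p (i - 1)) * (D ^^ i) \<phi>) + volterra (- pdy a b f) \<phi>"
    unfolding U rder_def prod.case by (rule act_eq) (auto intro: N)
  also have "\<dots> = diag f * \<phi> + (\<Sum>i<N. p i * (D ^^ Suc i) \<phi>) + volterra (- pdy a b f) \<phi>"
    unfolding sum.lessThan_Suc_shift by (simp only: simp_thms if_True funpow_0 nat.distinct if_False diff_Suc_1)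
  also have "\<dots> = (\<Sum>i<N. p i * (D ^^ i) (D \<phi>)) + volterra f (D \<phi>)"
    unfolding volterra_ideriv[OF F(3) assms(2)] funpow_Suc_right o_apply by (simp only: ac_simps)
  also have "\<dots> = act U (D \<phi>)"
    unfolding U actU ..
  finally show ?thesis .
qed

lemma lder_Formal:
  assumes "U \<in> Formal"
  shows "lder a b U \<in> Formal"
proof -
  obtain p f where U: "U = (p, f)" by fastforce
  note F = FormalD[OF assms[unfolded U]]
  have "D (p k) = 0" if "p k = 0" for k
    unfolding that by (rule ideriv_zero[OF ab])
  then have "k \<in> insert 0 ({i. p i \<noteq> 0} \<union> Suc ` {i. p i \<noteq> 0})"
    if "D (p k) + (if k = 0 then diag f else p (k - 1)) \<noteq> 0" for k
    using that by (cases k) force+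
  then have "{k. D (p k) + (if k = 0 then diag f else p (k - 1)) \<noteq> 0}
      \<subseteq> insert 0 ({i. p i \<noteq> 0} \<union> Suc ` {i. p i \<noteq> 0})"
    by blast
  then have "finite {k. D (p k) + (if k = 0 then diag f else p (k - 1)) \<noteq> 0}"
    by (rule finite_subset) (use F in simp)
  moreover have "D (p k) + (if k = 0 then diag f else p (k - 1)) \<in> B1 a b" for k
    by (intro B1_add ideriv_B1 F) (use F in \<open>simp add: diag_B1\<close>)
  ultimately show ?thesis
    unfolding U lder_def prod.case using B2_D(2)[OF F(3)] by (intro FormalI)
qed

text \<open>
  Left multiplication by \<open>\<partial>\<^sub>x\<close> differentiates the result: Leibniz' rule on each term of the
  differential part, and differentiation of the integral for the kernel.
\<close>

lemma act_lder:
  assumes "U \<in> Formal" "\<phi> \<in> Mab a b"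
  shows "act (lder a b U) \<phi> = D (act U \<phi>)"
proof -
  obtain p f where U: "U = (p, f)" by fastforce
  note F = FormalD[OF assms(1)[unfolded U]]
  obtain N where N: "\<And>i. N \<le> i \<Longrightarrow> p i = 0"
    using Formal_supp assms U by metis
  have actU: "act (p, f) \<psi> = (\<Sum>i<N. p i * (D ^^ i) \<psi>) + volterra f \<psi>" for \<psi>
    by (rule act_eq) (rule N)
  note D\<phi> = ideriv_pow_B1[OF Mab_B1[OF assms(2)]]
  have "act (lder a b U) \<phi> = (\<Sum>i<Suc N. (D (p i) + (if i = 0 then diag f else p (i - 1))) * (D ^^ i) \<phi>)
      + volterra (pdx a b f) \<phi>"
    unfolding U lder_def prod.case
  proof (rule act_eq)
    fix i assume "Suc N \<le> i"
    then show "D (p i) + (if i = 0 then diag f else p (i - 1)) = 0"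
      using N[of i] N[of "i - 1"] ideriv_zero[OF ab] by (cases i) (simp_all only: if_False add_0_left diff_Suc_1 nat.distinct Suc_le_mono le_SucI)
  qed
  also have "\<dots> = (\<Sum>i<N. D (p i) * (D ^^ i) \<phi>) + (\<Sum>i<N. p i * (D ^^ Suc i) \<phi>) + (diag f * \<phi> + volterra (pdx a b f) \<phi>)"
  proof -
    have "(\<Sum>i<Suc N. D (p i) * (D ^^ i) \<phi>) = (\<Sum>i<N. D (p i) * (D ^^ i) \<phi>)"
      unfolding sum.lessThan_Suc N[OF order_refl] ideriv_zero[OF ab] by (simp only: mult_zero_left add_0_right)
    moreover have "(\<Sum>i<Suc N. (if i = 0 then diag f else p (i - 1)) * (D ^^ i) \<phi>)
        = diag f * \<phi> + (\<Sum>i<N. p i * (D ^^ Suc i) \<phi>)"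
      unfolding sum.lessThan_Suc_shift by (simp only: simp_thms if_True funpow_0 nat.distinct if_False diff_Suc_1)
    ultimately show ?thesis
      unfolding distrib_right sum.distrib by (simp only: ac_simps)
  qed
  also have "\<dots> = (\<Sum>i<N. D (p i * (D ^^ i) \<phi>)) + D (volterra f \<phi>)"
    unfolding ideriv_volterra[OF F(3) Mab_B1[OF assms(2)]] ideriv_mult[OF F(1) D\<phi>] sum.distrib
    by (simp only: funpow.simps o_apply)
  also have "\<dots> = D (act U \<phi>)"
    unfolding U
    unfolding actU
    by (subst ideriv_add, intro sum_B1 B1_mult F D\<phi>,
      intro volterra_B1 F Mab_B1 assms, subst ideriv_sum, intro B1_mult F D\<phi>) (rule refl)
  finally show ?thesis .
qed

lemma lder_pow_Formal: "U \<in> Formal \<Longrightarrow> (lder a b ^^ i) U \<in> Formal"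
  by (induction i) (simp_all add: lder_Formal)

lemma rder_pow_Formal: "U \<in> Formal \<Longrightarrow> (rder a b ^^ i) U \<in> Formal"
  by (induction i) (simp_all add: rder_Formal)

lemma act_lder_pow: "U \<in> Formal \<Longrightarrow> \<phi> \<in> Mab a b \<Longrightarrow> act ((lder a b ^^ i) U) \<phi> = (D ^^ i) (act U \<phi>)"
  by (induction i) (simp_all only: funpow.simps id_apply o_apply act_lder lder_pow_Formal)

lemma act_rder_pow: "U \<in> Formal \<Longrightarrow> \<phi> \<in> Mab a b \<Longrightarrow> act ((rder a b ^^ i) U) \<phi> = act U ((D ^^ i) \<phi>)"
proof (induction i arbitrary: \<phi>)
  case (Suc i)
  have "act ((rder a b ^^ Suc i) U) \<phi> = act ((rder a b ^^ i) U) (D \<phi>)"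
    unfolding funpow.simps o_apply by (rule act_rder[OF rder_pow_Formal[OF Suc.prems(1)] Suc.prems(2)])
  also have "\<dots> = act U ((D ^^ Suc i) \<phi>)"
    unfolding funpow_Suc_right o_apply by (rule Suc.IH[OF Suc.prems(1) ideriv_Mab[OF Suc.prems(2)]])
  finally show ?case .
qed simp

text \<open>
  The three summands of the product are matched with the three parts of the composite: the
  differential part of \<open>U\<close> after the whole of \<open>W\<close>, and the kernel of \<open>U\<close> after the differential part
  and after the kernel of \<open>W\<close>.
\<close>

lemma
  assumes "U \<in> Formal" "W \<in> Formal"
  shows istar_mult_Formal: "istar_mult a b U W \<in> Formal"
    and act_mult: "\<phi> \<in> Mab a b \<Longrightarrow> act (istar_mult a b U W) \<phi> = act U (act W \<phi>)"
proof -
  obtain p f q g where UW: "U = (p, f)" "W = (q, g)" by fastforce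
  note F = FormalD[OF assms(1)[unfolded UW]] and G = FormalD[OF assms(2)[unfolded UW]]
  have W: "(q, g) \<in> Formal" using assms UW by simp
  define L where "L i = lmul (p i) ((lder a b ^^ i) (q, g))" for i
  define R where "R j = (rder a b ^^ j) (theta (\<lambda>(x, y). q j y * f (x, y)))" for j
  have th: "theta (\<lambda>(x, y). q j y * f (x, y)) \<in> Formal" for j
    using B2_mult[OF iny_B2[OF G(1)[of j]] F(3)] unfolding iny_times[OF F(3)] by (rule theta_Formal)
  have LF: "L i \<in> Formal" and RF: "R i \<in> Formal" for i
    unfolding L_def R_def by (intro lmul_Formal F lder_pow_Formal rder_pow_Formal W th)+
  have eq: "istar_mult a b U W =
      (\<Sum>i | p i \<noteq> 0. L i) + (\<Sum>j | q j \<noteq> 0. R j) + theta (conv a b f g)"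
    unfolding UW istar_mult_def prod.case L_def R_def ..
  show "istar_mult a b U W \<in> Formal"
    unfolding eq by (intro Formal_plus Formal_sum LF RF theta_Formal conv_B2 F G)
  show "act (istar_mult a b U W) \<phi> = act U (act W \<phi>)" if \<phi>: "\<phi> \<in> Mab a b"
  proof -
    note \<phi>B = Mab_B1[OF \<phi>]
    have oL: "act (L i) \<phi> = p i * (D ^^ i) (act W \<phi>)" for i
      unfolding L_def act_lmul[OF lder_pow_Formal[OF W]] act_lder_pow[OF W \<phi>] UW ..
    have oR: "act (R j) \<phi> = volterra f (q j * (D ^^ j) \<phi>)" for j
      unfolding R_def act_rder_pow[OF th \<phi>] act_theta volterra_iny ..
    have "act (istar_mult a b U W) \<phi> =
        (\<Sum>i | p i \<noteq> 0. act (L i) \<phi>) + (\<Sum>j | q j \<noteq> 0. act (R j) \<phi>) + volterra (conv a b f g) \<phi>"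
      unfolding eq
      by (subst act_add_left, intro Formal_plus Formal_sum LF RF, intro theta_Formal conv_B2 F G, rule \<phi>,
        subst act_add_left, intro Formal_sum LF, intro Formal_sum RF, rule \<phi>)
        (simp only: act_sum_left[OF LF \<phi>] act_sum_left[OF RF \<phi>] act_theta)
    also have "\<dots> = (\<Sum>i | p i \<noteq> 0. p i * (D ^^ i) (act W \<phi>)) + volterra f (\<Sum>j | q j \<noteq> 0. q j * (D ^^ j) \<phi>) + volterra f (volterra g \<phi>)"
      unfolding oL oR volterra_conv[OF F(3) G(3) \<phi>B]
      by (subst volterra_sum_right[OF F(3)], intro B1_mult G ideriv_pow_B1 \<phi>B) (rule refl)
    also have "\<dots> = (\<Sum>i | p i \<noteq> 0. p i * (D ^^ i) (act W \<phi>)) + volterra f (act W \<phi>)"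
      unfolding UW act_pair
      by (subst volterra_add_right[OF F(3) _ volterra_B1[OF G(3) \<phi>B]], intro sum_B1 B1_mult G ideriv_pow_B1 \<phi>B)
        (simp only: ac_simps)
    also have "\<dots> = act U (act W \<phi>)"
      unfolding UW(1) act_pair ..
    finally show ?thesis .
  qed
qed

section \<open>The isomorphism\<close>

lemma Phi_in: "\<phi> \<in> Mab a b \<Longrightarrow> Phi U \<phi> = act U \<phi>"
  and Phi_out: "\<phi> \<notin> Mab a b \<Longrightarrow> Phi U \<phi> = 0"
  by (simp_all add: Phi_def on_M_def)

lemma Phi_End_M:
  assumes "U \<in> Formal"
  shows "Phi U \<in> carrier (End_M a b)"
  by (rule End_M_I)
    (simp_all only: Phi_in Phi_out add_Mab scale_Mab act_Mab[OF assms] act_add_right[OF assms]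
      act_scale_right not_False_eq_True)

lemma I_star_ops:
  "U \<otimes>\<^bsub>I_star a b\<^esub> W = istar_mult a b U W" "U \<oplus>\<^bsub>I_star a b\<^esub> W = U + W"
  "c \<odot>\<^bsub>I_star a b\<^esub> (p, f) = (\<lambda>k x. c * p k x, \<lambda>z. c * f z)"
  "\<one>\<^bsub>I_star a b\<^esub> = beta (unit1 a b) 0" "\<zero>\<^bsub>I_star a b\<^esub> = 0"
  by (simp_all add: I_star_def)

lemma Phi_add:
  assumes "U \<in> Formal" "W \<in> Formal"
  shows "Phi (U + W) = Phi U + Phi W"
proof (rule End_M_eqI)
  show "Phi (U + W) \<phi> = (Phi U + Phi W) \<phi>" if "\<phi> \<in> Mab a b" for \<phi>
    unfolding plus_fun_apply[of "Phi U" "Phi W"] Phi_in[OF that] by (rule act_add_left[OF assms that])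
qed (intro Phi_End_M Formal_plus End_M_closed assms)+

lemma Phi_mult:
  assumes "U \<in> Formal" "W \<in> Formal"
  shows "Phi (istar_mult a b U W) = Phi U \<circ> Phi W"
proof (rule End_M_eqI)
  show "Phi (istar_mult a b U W) \<phi> = (Phi U \<circ> Phi W) \<phi>" if "\<phi> \<in> Mab a b" for \<phi>
    unfolding o_apply Phi_in[OF that] Phi_in[OF act_Mab[OF assms(2) that]]
    by (rule act_mult[OF assms that])
qed (intro Phi_End_M istar_mult_Formal End_M_closed assms)+

lemma smult_Formal:
  assumes "U \<in> Formal"
  shows "c \<odot>\<^bsub>I_star a b\<^esub> U \<in> Formal"
proof -
  obtain p f where U: "U = (p, f)" by fastforce
  note F = FormalD[OF assms[unfolded U]]
  have "finite {k. (\<lambda>x. c * p k x) \<noteq> 0}"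
    by (rule finite_subset[OF _ F(2)]) (auto simp: fun_eq_iff)
  then show ?thesis
    unfolding U I_star_ops by (intro FormalI B1_scale B2_scale F)
qed

lemma Phi_smult:
  assumes "U \<in> Formal"
  shows "Phi (c \<odot>\<^bsub>I_star a b\<^esub> U) = (\<lambda>\<phi> x. c * Phi U \<phi> x)"
proof (rule End_M_eqI)
  obtain p f where U: "U = (p, f)" by fastforce
  obtain N where N: "\<And>i. N \<le> i \<Longrightarrow> p i = 0"
    using Formal_supp assms U by metis
  have actU: "act (p, f) \<phi> = (\<Sum>i<N. p i * (D ^^ i) \<phi>) + volterra f \<phi>" for \<phi>
    by (rule act_eq) (rule N)
  have actcU: "act (\<lambda>k x. c * p k x, \<lambda>z. c * f z) \<phi> =
      (\<Sum>i<N. (\<lambda>x. c * p i x) * (D ^^ i) \<phi>) + volterra (\<lambda>z. c * f z) \<phi>" for \<phi>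
    by (rule act_eq) (simp add: N fun_eq_iff)
  show "Phi (c \<odot>\<^bsub>I_star a b\<^esub> U) \<phi> = (\<lambda>x. c * Phi U \<phi> x)" if "\<phi> \<in> Mab a b" for \<phi>
    unfolding Phi_in[OF that] U I_star_ops actU actcU volterra_scale_left
    by (rule ext) (simp add: sum_fun_apply sum_distrib_left algebra_simps)
qed (intro Phi_End_M smult_Formal End_M_closed assms)+

lemma Phi_zero: "Phi 0 = 0"
  by (rule End_M_eqI) (simp_all add: Phi_End_M zero_Formal End_M_closed Phi_in act_zero_left)

lemma Phi_theta: "Phi (theta f) = volterra_op a b f"
  by (rule ext) (simp add: Phi_def volterra_op_def on_M_def act_theta volterra_def restr_def)

lemma Phi_beta_0: "Phi (beta P 0) = mult_op a b P"
  by (rule ext) (simp add: Phi_def mult_op_def on_M_def act_beta)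

text \<open>
  The powers of \<open>\<partial>\<^sub>x\<close> are reached inside the generated algebra by composing with the derivative
  one step at a time.
\<close>

lemma Phi_beta_Suc: "Phi (beta P (Suc n)) = Phi (beta P n) \<circ> deriv_op a b"
proof
  fix \<phi>
  have "act (beta P n) 0 = 0"
    using act_scale_right[OF zero_Mab, of "beta P n" 0] by (simp add: zero_fun_def)
  then show "Phi (beta P (Suc n)) \<phi> = (Phi (beta P n) \<circ> deriv_op a b) \<phi>"
    by (cases "\<phi> \<in> Mab a b")
      (simp_all only: Phi_def on_M_def deriv_op_def o_apply if_True if_False ideriv_Mab zero_Mab
        act_beta funpow_Suc_right)
qed

lemma Phi_deriv: "Phi (beta (unit1 a b) 1) = deriv_op a b"
proof
  show "Phi (beta (unit1 a b) 1) \<phi> = deriv_op a b \<phi>" for \<phi>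
  proof (cases "\<phi> \<in> Mab a b")
    case True
    then show ?thesis
      using unit1_times[OF ideriv_B1[OF Mab_B1[OF True]]]
      by (simp only: Phi_in deriv_op_def on_M_def if_True act_beta funpow_Suc_right funpow_0 One_nat_def o_apply)
  qed (simp only: Phi_out deriv_op_def on_M_def if_False not_False_eq_True)
qed

lemma Phi_one: "Phi (beta (unit1 a b) 0) = on_M a b id"
proof
  show "Phi (beta (unit1 a b) 0) \<phi> = on_M a b id \<phi>" for \<phi>
    using unit1_times[OF Mab_B1, of \<phi>]
    by (cases "\<phi> \<in> Mab a b")
      (simp_all only: Phi_in Phi_out on_M_def if_True if_False act_beta funpow_0 id_apply not_False_eq_True)
qed

text \<open>
  The kernel is shown to vanish first, because the argument for the coefficients evaluates the
  operator at a point and needs the integral out of the way.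
\<close>

lemma Phi_eq_zero:
  assumes "U \<in> Formal" "Phi U = 0"
  shows "U = 0"
proof -
  obtain p f where U: "U = (p, f)" by fastforce
  note F = FormalD[OF assms(1)[unfolded U]]
  have zero: "act (p, f) \<phi> = 0" if "\<phi> \<in> Mab a b" for \<phi>
    using assms(2) Phi_in[OF that, of U] unfolding U by (simp only: zero_fun_apply)
  have f: "f = 0"
    by (rule B2_zero_if_zero_inside[OF F(3) act_zero_kernel[OF F(2,3) zero]])
  have "p = 0"
    by (rule act_zero_coeff[OF F(2,1)]) (use zero f in blast)
  then show ?thesis
    unfolding U f zero_prod_def by (simp only:)
qed

lemma Phi_inj:
  assumes "U \<in> Formal" "W \<in> Formal" "Phi U = Phi W"
  shows "U = W"
proof -
  let ?m = "(-1) \<odot>\<^bsub>I_star a b\<^esub> W"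
  have "Phi (U + ?m) = 0"
    unfolding Phi_add[OF assms(1) smult_Formal[OF assms(2)]] Phi_smult[OF assms(2)] assms(3)
    by (rule ext, rule ext) simp
  then have "U + ?m = 0"
    by (intro Phi_eq_zero Formal_plus smult_Formal assms)
  moreover have "?m = - W"
    by (cases W) (simp add: I_star_ops fun_eq_iff)
  ultimately show ?thesis by simp
qed

lemma formal_decomposition:
  assumes "(p, f) \<in> Formal"
  shows "(p, f) = (\<Sum>i | p i \<noteq> 0. beta (p i) i) + theta f"
proof -
  have fin: "finite {i. p i \<noteq> 0}"
    by (rule FormalD[OF assms])
  have "(\<Sum>i\<in>I. beta (p i) i) = (\<lambda>k. if k \<in> I then p k else 0, 0)" if "finite I" for I
    using that by induction (auto simp: beta_def zero_prod_def fun_eq_iff)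
  from this[OF fin] have "(\<Sum>i | p i \<noteq> 0. beta (p i) i) = (p, 0)"
    by (auto simp: fun_eq_iff)
  then show ?thesis
    by (simp add: theta_def)
qed

abbreviation gens :: "((real \<Rightarrow> complex) \<Rightarrow> real \<Rightarrow> complex) set" where
  "gens \<equiv> mult_op a b ` B1 a b \<union> {deriv_op a b} \<union> volterra_op a b ` B2 a b"

lemma I_M_carrier: "carrier (I_M a b) = generated_subalgebra (End_M a b) gens"
  by (simp add: I_M_def)

lemma I_M_ops:
  "S \<otimes>\<^bsub>I_M a b\<^esub> T = S \<circ> T" "S \<oplus>\<^bsub>I_M a b\<^esub> T = S + T" "c \<odot>\<^bsub>I_M a b\<^esub> T = (\<lambda>\<phi> x. c * T \<phi> x)"
  "\<one>\<^bsub>I_M a b\<^esub> = on_M a b id" "\<zero>\<^bsub>I_M a b\<^esub> = 0"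
  by (simp_all add: I_M_def End_M_def)

lemma I_M_closed:
  "S \<in> carrier (I_M a b) \<Longrightarrow> T \<in> carrier (I_M a b) \<Longrightarrow> S \<circ> T \<in> carrier (I_M a b)"
  "S \<in> carrier (I_M a b) \<Longrightarrow> T \<in> carrier (I_M a b) \<Longrightarrow> S + T \<in> carrier (I_M a b)"
  "S \<in> carrier (I_M a b) \<Longrightarrow> (\<lambda>\<phi> x. c * S \<phi> x) \<in> carrier (I_M a b)"
  "on_M a b id \<in> carrier (I_M a b)"
  using generated_subalgebra.intros(2-)[where A = "End_M a b" and S = gens]
  unfolding I_M_carrier End_M_ops by blast+

text \<open>
  The image contains the generators and is closed under the operations; conversely a formal sum is
  the finite sum of its monomials, each of which acts as a product of generators, and of a kernel.
\<close>

lemma Phi_image: "Phi ` Formal = carrier (I_M a b)"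
proof
  show "carrier (I_M a b) \<subseteq> Phi ` Formal"
  proof
    fix T assume "T \<in> carrier (I_M a b)"
    then show "T \<in> Phi ` Formal"
      unfolding I_M_carrier
    proof induction
      case (gen T)
      then consider P where "P \<in> B1 a b" "T = Phi (beta P 0)" | "T = Phi (beta (unit1 a b) 1)"
        | f where "f \<in> B2 a b" "T = Phi (theta f)"
        unfolding Phi_theta Phi_beta_0 Phi_deriv by blast
      then show ?case
        by cases (blast intro: beta_Formal theta_Formal unit1_B1)+
    next
      case one
      show ?case
        unfolding End_M_ops Phi_one[symmetric] by (intro imageI beta_Formal unit1_B1)
    next
      case (add S T)
      then show ?case
        unfolding End_M_ops by (auto simp only: Phi_add[symmetric] intro!: imageI Formal_plus)
    next
      case (smult T c)
      then show ?case
        unfolding End_M_ops by (auto simp only: Phi_smult[symmetric] intro!: imageI smult_Formal)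
    next
      case (mult S T)
      then show ?case
        unfolding End_M_ops by (auto simp only: Phi_mult[symmetric] intro!: imageI istar_mult_Formal)
    qed
  qed
  show "Phi ` Formal \<subseteq> carrier (I_M a b)"
  proof (rule image_subsetI)
    fix U assume "U \<in> Formal"
    moreover obtain p f where U: "U = (p, f)" by fastforce
    ultimately have pf: "(p, f) \<in> Formal" by simp
    note F = FormalD[OF pf]
    have "deriv_op a b \<in> carrier (I_M a b)"
      unfolding I_M_carrier by (intro generated_subalgebra.gen) blast
    moreover have "mult_op a b P \<in> carrier (I_M a b)" if "P \<in> B1 a b" for P
      unfolding I_M_carrier using that by (intro generated_subalgebra.gen) blast
    ultimately have beta: "Phi (beta P n) \<in> carrier (I_M a b)" if "P \<in> B1 a b" for P n
      using that by (induction n) (simp_all only: Phi_beta_0 Phi_beta_Suc I_M_closed)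
    have "(\<lambda>\<phi> x. 0 * on_M a b id \<phi> x) \<in> carrier (I_M a b)"
      by (intro I_M_closed)
    then have zero: "0 \<in> carrier (I_M a b)"
      by (simp add: zero_fun_def)
    have "Phi (\<Sum>i\<in>I. beta (p i) i) \<in> carrier (I_M a b)" for I
      by (induction I rule: infinite_finite_induct)
        (simp_all only: sum.infinite sum.empty sum.insert not_False_eq_True Phi_zero zero
          Phi_add Formal_sum beta_Formal F beta I_M_closed)
    moreover have "Phi (theta f) \<in> carrier (I_M a b)"
      unfolding Phi_theta I_M_carrier using F(3) by (intro generated_subalgebra.gen) blast
    ultimately show "Phi U \<in> carrier (I_M a b)"
      unfolding U by (subst formal_decomposition[OF pf])
        (simp only: Phi_add Formal_sum beta_Formal theta_Formal F I_M_closed)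
  qed
qed

lemma I_M_subset: "carrier (I_M a b) \<subseteq> carrier (End_M a b)"
  unfolding Phi_image[symmetric] using Phi_End_M by blast

lemma I_M_algebra: "complex_algebra (I_M a b)"
proof (rule complex_algebra_pullback[OF End_M_algebra, where h = "\<lambda>T. T"]; (unfold I_M_ops End_M_ops)?)
  show "0 \<in> carrier (I_M a b)"
    using imageI[OF zero_Formal, of Phi] unfolding Phi_image Phi_zero .
qed (use I_M_subset in \<open>auto intro: I_M_closed\<close>)

lemma I_star_algebra: "complex_algebra (I_star a b)"
proof (rule complex_algebra_pullback[OF End_M_algebra, where h = Phi]; (unfold I_star_ops(1,2,4,5) End_M_ops)?)
qed (simp_all only: Formal_plus istar_mult_Formal smult_Formal zero_Formal beta_Formal unit1_B1
    Phi_End_M Phi_add Phi_mult Phi_smult Phi_zero Phi_one Phi_inj)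

lemma Phi_algebra_iso: "Phi \<in> algebra_iso (I_star a b) (I_M a b)"
proof -
  have "inj_on Phi Formal"
    by (rule inj_onI) (rule Phi_inj)
  then have "bij_betw Phi Formal (carrier (I_M a b))"
    unfolding bij_betw_def using Phi_image by blast
  moreover have "Phi \<in> Formal \<rightarrow> carrier (I_M a b)"
    using Phi_image by blast
  ultimately show ?thesis
    unfolding algebra_iso_def ring_iso_def ring_hom_def mem_Collect_eq I_star_ops(1,2,4,5) I_M_ops
    by (intro conjI allI ballI impI) (simp_all only: Phi_add Phi_mult Phi_smult Phi_one)
qed

end

theorem theorem2:
  fixes a b :: real
  assumes "a < b"
  shows "complex_algebra (I_star a b) \<and> complex_algebra (I_M a b) \<and>
    algebra_isomorphic (I_star a b) (I_M a b)"
proof -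
  interpret proper_interval a b
    by (rule proper_interval.intro) (rule assms)
  show ?thesis
    unfolding algebra_isomorphic_def
    using I_star_algebra I_M_algebra Phi_algebra_iso by blast
qed

end
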